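(* Let $b$ be a positive integer and $a$ a positive real number with $a<b+1$, and suppose that the improper integral $\int_0^{+\infty}\frac{\sin^b x}{x^a}\,dx$ converges. Then $$\int_0^{+\infty}\frac{\sin^b x}{x^a}\,dx=\frac{\pi}{2^{b-1}\,\Gamma(a)}\lim_{\alpha\to a}\left|\sum_{k=1}^{b}k^{\alpha-1}\,t_k\,C_b^{\frac{b-k}{2}}\,\frac{\sin\frac{(\alpha+b)\pi}{2}}{\sin\alpha\pi}\right|,$$ where, for $1\le k\le b$, $$t_k=\frac{\left[1+(-1)^{b-k}\right](-1)^{\lfloor k/2\rfloor}}{2}.$$ (In particular, the limit exists.)
   Context: $\Gamma$ is the Gamma function and $C_n^m=\binom{n}{m}$ is the binomial coefficient. When $b-k$ is odd, $t_k=0$ and the corresponding term of the sum is taken to be $0$, so only $k$ with the same parity as $b$ contribute. The limit is over real $\alpha\to a$ with $\alpha\ne a$ (near $a$, so that $\sin\alpha\pi\neq0$). The integral $\int_0^{+\infty} f(x)\,dx$ is an improper Riemann integral at both ends: it converges if both $\lim_{\varepsilon\to 0^+}\int_\varepsilon^1 f(x)\,dx$ and $\lim_{R\to+\infty}\int_1^R f(x)\,dx$ exist and are finite. *)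

theory Defs
  imports "HOL-Analysis.Analysis"
begin

text \<open>
  Integrals over $(0,\infty)$, improper at both ends. The proper integrals over compact
  subintervals are the gauge integrals of the library, which agree with the Riemann integral
  for every Riemann integrable (in particular every continuous) function. Integrability on
  compact subintervals is demanded explicitly because \<open>integral\<close> is total, with
  value 0 for functions that are not integrable.
\<close>

definition has_improper_integral :: "(real \<Rightarrow> real) \<Rightarrow> real \<Rightarrow> bool" where
  "has_improper_integral f I \<longleftrightarrow>
     (\<forall>c d. 0 < c \<longrightarrow> c \<le> d \<longrightarrow> f integrable_on {c..d}) \<and>
     (\<exists>I\<^sub>0 I\<^sub>1. ((\<lambda>\<epsilon>. integral {\<epsilon>..1} f) \<longlongrightarrow> I\<^sub>0) (at_right 0) \<and>
              ((\<lambda>R. integral {1..R} f) \<longlongrightarrow> I\<^sub>1) at_top \<and>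
              I = I\<^sub>0 + I\<^sub>1)"

definition improper_integral_converges :: "(real \<Rightarrow> real) \<Rightarrow> bool" where
  "improper_integral_converges f \<longleftrightarrow> (\<exists>I. has_improper_integral f I)"

definition improper_integral :: "(real \<Rightarrow> real) \<Rightarrow> real" where
  "improper_integral f = (THE I. has_improper_integral f I)"

lemma has_improper_integral_unique:
  assumes "has_improper_integral f I" "has_improper_integral f J"
  shows "I = J"
proof -
  obtain I0 I1 where I: "((\<lambda>\<epsilon>. integral {\<epsilon>..1} f) \<longlongrightarrow> I0) (at_right 0)"
      "((\<lambda>R. integral {1..R} f) \<longlongrightarrow> I1) at_top" "I = I0 + I1"
    using assms(1) unfolding has_improper_integral_def by blast
  obtain J0 J1 where J: "((\<lambda>\<epsilon>. integral {\<epsilon>..1} f) \<longlongrightarrow> J0) (at_right 0)"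
      "((\<lambda>R. integral {1..R} f) \<longlongrightarrow> J1) at_top" "J = J0 + J1"
    using assms(2) unfolding has_improper_integral_def by blast
  have "I0 = J0" by (rule tendsto_unique[OF _ I(1) J(1)]) simp
  moreover have "I1 = J1" by (rule tendsto_unique[OF _ I(2) J(2)]) simp
  ultimately show ?thesis using I(3) J(3) by simp
qed

lemma improper_integral_eqI:
  "has_improper_integral f I \<Longrightarrow> improper_integral f = I"
  unfolding improper_integral_def
  by (rule the_equality) (auto intro: has_improper_integral_unique)

text \<open>Used only for $1 \le k \le b$, so the truncated subtraction is the true one.\<close>

definition t_coeff :: "nat \<Rightarrow> nat \<Rightarrow> real" where
  "t_coeff b k = (1 + (-1) ^ (b - k)) * (-1) ^ (k div 2) / 2"

end

theory Submission
  imports Defs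
begin

text \<open>
  Write $x^{-a} = \Gamma(a)^{-1} \int_0^\infty t^{a-1} e^{-xt}\,dt$ and exchange the integrals over
  $[0, N\pi] \times (0,\infty)$. By the Fourier expansion of $\sin^b$,
  $\int_0^{N\pi} \sin^b x\, e^{-xt}\,dx = L(t)\,(1 - (-1)^{bN} e^{-N\pi t})$ with
  $L(t) = M(t)$ for odd $b$ and $L(t) = M(t)/t$ for even $b$, where
  $M(t) = \sum_k d_k/(t^2+k^2) \ge 0$. Letting $N \to \infty$, the integral becomes
  $\Gamma(a)^{-1} \int_0^\infty t^{\beta-1} M(t)\,dt$ with $\beta = a$ or $\beta = a - 1$.

  This Mellin transform is continuous in $\beta$. No analytic continuation is needed to evaluate
  it: $M$ decays so fast that $t^{2m} M(t) = \sum_k d_k (-k^2)^m/(t^2+k^2)$ whenever $2m < \beta$,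
  and for $2m < \beta < 2m+2$ each summand is integrated by
  $\int_0^\infty t^{s-1}/(t^2+k^2)\,dt = k^{s-2}\,\pi/(2\sin(\pi s/2))$, $0 < s < 2$.
  For even $b$ and $a \le 1$ the given integral diverges like the harmonic series.
\<close>

section \<open>Fourier expansion of powers of the sine\<close>

text \<open>Binomial theorem for (e^(-iy) + e^(iy))^b, followed by taking real parts.\<close>

lemma cos_power_expansion:
  fixes y :: real
  shows "cos y ^ b = (\<Sum>j\<le>b. real (b choose j) * cos ((real b - 2 * real j) * y)) / 2 ^ b"
proof -
  have "2 * complex_of_real (cos y) = cis (- y) + cis y"
    by (simp add: complex_eq_iff)
  then have "complex_of_real (2 ^ b * cos y ^ b) = (cis (- y) + cis y) ^ b"
    by (metis of_real_mult of_real_numeral of_real_power power_mult_distrib)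
  also have "\<dots> = (\<Sum>j\<le>b. of_nat (b choose j) * cis (- y) ^ j * cis y ^ (b - j))"
    by (rule binomial_ring)
  also have "\<dots> = (\<Sum>j\<le>b. of_real (real (b choose j)) * cis ((real b - 2 * real j) * y))"
  proof (intro sum.cong refl)
    fix j assume "j \<in> {..b}"
    then have "real j * - y + real (b - j) * y = (real b - 2 * real j) * y"
      by (simp add: of_nat_diff algebra_simps)
    then have "cis (- y) ^ j * cis y ^ (b - j) = cis ((real b - 2 * real j) * y)"
      by (simp only: Complex.DeMoivre cis_mult)
    then show "of_nat (b choose j) * cis (- y) ^ j * cis y ^ (b - j) =
        of_real (real (b choose j)) * cis ((real b - 2 * real j) * y)"
      by (simp add: mult.assoc)
  qed
  finally have "2 ^ b * cos y ^ b = Re (\<Sum>j\<le>b. of_real (real (b choose j)) * cis ((real b - 2 * real j) * y))"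
    by (metis Re_complex_of_real)
  then show ?thesis
    by (simp add: field_simps)
qed

text \<open>The indices j and b - j carry equal binomial coefficients and opposite arguments, so for
  an even function they pair up under k = |b - 2j|. Only the central index j = b/2, present for even
  b, stays alone.\<close>

lemma sum_binomial_even_function:
  fixes f :: "real \<Rightarrow> real"
  assumes f: "\<And>x. f (- x) = f x"
  shows "(\<Sum>j\<le>b. real (b choose j) * f (real b - 2 * real j)) =
    (if even b then real (b choose (b div 2)) * f 0 else 0) +
    2 * (\<Sum>k | k \<in> {1..b} \<and> even (b - k). real (b choose ((b - k) div 2)) * f (real k))"
proof -
  let ?g = "\<lambda>j. real (b choose j) * f (real b - 2 * real j)"
  let ?K = "{k \<in> {1..b}. even (b - k)}"
  let ?h = "\<lambda>k. real (b choose ((b - k) div 2)) * f (real k)"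
  have low: "sum ?g {j. 2 * j < b} = sum ?h ?K"
    by (rule sum.reindex_bij_witness[where i = "\<lambda>k. (b - k) div 2" and j = "\<lambda>j. b - 2 * j"])
      (auto simp: of_nat_diff)
  have high: "sum ?g {j. j \<le> b \<and> b < 2 * j} = sum ?h ?K"
  proof (rule sum.reindex_bij_witness[where i = "\<lambda>k. (b + k) div 2" and j = "\<lambda>j. 2 * j - b"])
    fix j assume j: "j \<in> {j. j \<le> b \<and> b < 2 * j}"
    then have "(b - (2 * j - b)) div 2 = b - j" by auto
    moreover have "f (real (2 * j - b)) = f (real b - 2 * real j)"
      using j f[of "real b - 2 * real j"] by (simp add: of_nat_diff)
    ultimately show "?h (2 * j - b) = ?g j"
      using j binomial_symmetric[of j b] by simp
  next
    fix k assume "k \<in> ?K"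
    then have k: "1 \<le> k" "k \<le> b" "even (b + k)" by auto
    from k(3) obtain m where m: "b + k = 2 * m" by (elim evenE)
    with k show "(b + k) div 2 \<in> {j. j \<le> b \<and> b < 2 * j}" "2 * ((b + k) div 2) - b = k" by auto
  next
    fix j assume "j \<in> {j. j \<le> b \<and> b < 2 * j}"
    then show "(b + (2 * j - b)) div 2 = j" "2 * j - b \<in> ?K" by auto
  qed
  have mid: "sum ?g {j. 2 * j = b} = (if even b then real (b choose (b div 2)) * f 0 else 0)"
  proof (cases "even b")
    case True
    then have "{j. 2 * j = b} = {b div 2}" by auto
    with True show ?thesis by (auto elim!: evenE)
  qed (auto intro!: sum.neutral)
  have "{..b} = ({j. 2 * j < b} \<union> {j. 2 * j = b}) \<union> {j. j \<le> b \<and> b < 2 * j}" by auto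
  then have "sum ?g {..b} = sum ?g (({j. 2 * j < b} \<union> {j. 2 * j = b}) \<union> {j. j \<le> b \<and> b < 2 * j})"
    by simp
  also have "\<dots> = sum ?g {j. 2 * j < b} + sum ?g {j. 2 * j = b} + sum ?g {j. j \<le> b \<and> b < 2 * j}"
  proof -
    have fin: "finite {j. 2 * j < b}" "finite {j. 2 * j = b}"
      by (rule finite_subset[of _ "{..b}"]; auto)+
    show ?thesis
      using fin by (subst sum.union_disjoint; (subst sum.union_disjoint)?) auto
  qed
  finally show ?thesis
    unfolding low high mid by simp
qed

text \<open>The Fourier coefficient of sin^b at frequency k, with respect to cosines for even b and
  sines for odd b. The power of 2 is b - 1 rather than b because each frequency arises from two
  binomial terms.\<close>

definition sin_power_coeff :: "nat \<Rightarrow> nat \<Rightarrow> real" where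
  "sin_power_coeff b k = t_coeff b k * real (b choose ((b - k) div 2)) / 2 ^ (b - 1)"

text \<open>A shift by k quarter periods; the sign it produces is the one built into
  \<open>t_coeff\<close>.\<close>

lemma cos_shifted_multiple:
  "cos (real k * (x - pi / 2)) = (-1) ^ (k div 2) * (if even k then cos (real k * x) else sin (real k * x))"
proof (cases "even k")
  case True
  then obtain m where "k = 2 * m" by (auto elim: evenE)
  then show ?thesis
    by (simp add: algebra_simps cos_diff)
next
  case False
  then obtain m where k: "k = 2 * m + 1" by (auto elim: oddE)
  have "real k * (x - pi / 2) = (real k * x - pi / 2) - real m * pi"
    by (simp add: k algebra_simps)
  then have "cos (real k * (x - pi / 2)) = cos (real k * x - pi / 2) * (-1) ^ m"
    by (simp add: cos_diff)
  then show ?thesis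
    by (simp add: k cos_diff)
qed

text \<open>Since sin x = cos (x - pi/2), this is the cosine expansion at a shifted point, folded to
  nonnegative frequencies. The sum may run over all k because the coefficient vanishes when b - k is
  odd.\<close>

lemma sin_power_fourier:
  assumes "b \<ge> 1"
  shows "sin x ^ b = (if even b then real (b choose (b div 2)) / 2 ^ b else 0) +
    (\<Sum>k=1..b. sin_power_coeff b k * (if even b then cos (real k * x) else sin (real k * x)))"
proof -
  let ?y = "x - pi / 2"
  let ?T = "\<lambda>k. if even b then cos (real k * x) else sin (real k * x)"
  have "sin x ^ b = cos ?y ^ b"
    by (simp add: cos_diff)
  also have "\<dots> = (\<Sum>j\<le>b. real (b choose j) * (\<lambda>z. cos (z * ?y)) (real b - 2 * real j)) / 2 ^ b"
    by (subst cos_power_expansion) simp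
  also have "\<dots> = ((if even b then real (b choose (b div 2)) * (\<lambda>z. cos (z * ?y)) 0 else 0) +
    2 * (\<Sum>k | k \<in> {1..b} \<and> even (b - k). real (b choose ((b - k) div 2)) * (\<lambda>z. cos (z * ?y)) (real k))) / 2 ^ b"
    by (subst sum_binomial_even_function) auto
  also have "\<dots> = (if even b then real (b choose (b div 2)) / 2 ^ b else 0) +
    (\<Sum>k | k \<in> {1..b} \<and> even (b - k). real (b choose ((b - k) div 2)) * cos (real k * ?y)) * (2 / 2 ^ b)"
    by (simp add: add_divide_distrib)
  also have "2 / 2 ^ b = 1 / (2 ^ (b - 1) :: real)"
    using assms by (cases b) auto
  also have "(\<Sum>k | k \<in> {1..b} \<and> even (b - k). real (b choose ((b - k) div 2)) * cos (real k * ?y)) * (1 / 2 ^ (b - 1)) =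
     (\<Sum>k | k \<in> {1..b} \<and> even (b - k). sin_power_coeff b k * ?T k)"
    unfolding sum_distrib_right
    by (intro sum.cong refl)
       (auto simp: sin_power_coeff_def t_coeff_def cos_shifted_multiple)
  also have "\<dots> = (\<Sum>k=1..b. sin_power_coeff b k * ?T k)"
    by (rule sum.mono_neutral_left) (auto simp: sin_power_coeff_def t_coeff_def)
  finally show ?thesis .
qed

section \<open>Mellin transforms of inverse quadratics\<close>

text \<open>Bridge between the gauge integral, used for the substitution and the Beta integral, and
  \<open>lborel\<close>, used for Fubini and dominated convergence.\<close>

lemma set_integrable_lborel_iff:
  fixes f :: "real \<Rightarrow> real"
  assumes "f \<in> borel_measurable borel" "S \<in> sets borel"
  shows "set_integrable lborel S f \<longleftrightarrow> f absolutely_integrable_on S"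
  using assms unfolding set_integrable_def by (subst integrable_completion) auto

text \<open>The substitution u = t^2/(t^2 + k^2) maps the half-line onto (0,1) and produces the Beta
  integral with parameters s/2 and 1 - s/2. Euler's reflection formula evaluates it as pi/sin(pi
  s/2).\<close>

lemma Mellin_inverse_square:
  fixes s k :: real
  assumes s: "0 < s" "s < 2" and k: "k > 0"
  shows "set_integrable lborel {0<..} (\<lambda>t. t powr (s - 1) / (t\<^sup>2 + k\<^sup>2))"
    and "(LINT t:{0<..}|lborel. t powr (s - 1) / (t\<^sup>2 + k\<^sup>2)) =
           k powr (s - 2) * (pi / (2 * sin (pi * s / 2)))"
proof -
  define f where "f u = u powr (s / 2 - 1) * (1 - u) powr (1 - s / 2 - 1)" for u :: real
  define g where "g t = t\<^sup>2 / (t\<^sup>2 + k\<^sup>2)" for t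
  define g' where "g' t = 2 * t * k\<^sup>2 / (t\<^sup>2 + k\<^sup>2)\<^sup>2" for t
  define B where "B = Beta (s / 2) (1 - s / 2)"
  have pos: "t\<^sup>2 + k\<^sup>2 > 0" for t
    using k by (intro add_nonneg_pos) auto
  have fB: "(f has_integral B) {0<..<1}"
    using has_integral_Beta_real[of "s/2" "1 - s/2"] s
    unfolding f_def B_def by (simp add: has_integral_Icc_iff_Ioo)
  then have fabs: "f absolutely_integrable_on {0<..<1}"
    by (intro nonnegative_absolutely_integrable_1) (auto simp: f_def has_integral_iff)
  have der: "(g has_field_derivative g' t) (at t within {0<..})" for t
    unfolding g_def using pos[of t]
    by (auto intro!: derivative_eq_intros simp: g'_def field_simps power2_eq_square)
  have inj: "inj_on g {0<..}"
  proof (rule inj_onI)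
    fix x y :: real assume xy: "x \<in> {0<..}" "y \<in> {0<..}" "g x = g y"
    then have "x\<^sup>2 * k\<^sup>2 = y\<^sup>2 * k\<^sup>2"
      using pos[of x] pos[of y] by (simp add: g_def field_simps)
    with xy k show "x = y"
      by (simp add: power2_eq_iff_nonneg)
  qed
  have img: "g ` {0<..} = {0<..<1}"
  proof (intro equalityI subsetI)
    fix u assume "u \<in> g ` {0<..}"
    then show "u \<in> {0<..<1}" using k pos by (auto simp: g_def field_simps)
  next
    fix u :: real assume u: "u \<in> {0<..<1}"
    \<comment> \<open>The positive solution of t^2/(t^2 + k^2) = u.\<close>
    define t where "t = k * sqrt (u / (1 - u))"
    have t2: "t\<^sup>2 = k\<^sup>2 * (u / (1 - u))"
      using u by (simp add: t_def power_mult_distrib)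
    have "t\<^sup>2 + k\<^sup>2 = k\<^sup>2 / (1 - u)"
      using u unfolding t2 by (simp add: field_simps)
    then have "g t = u" using u k by (simp add: g_def t2)
    moreover have "t > 0" using u k by (simp add: t_def)
    ultimately show "u \<in> g ` {0<..}" by force
  qed
  have sub: "(\<lambda>t. \<bar>g' t\<bar> * f (g t)) absolutely_integrable_on {0<..} \<and>
      integral {0<..} (\<lambda>t. \<bar>g' t\<bar> * f (g t)) = B"
    using has_absolute_integral_change_of_variables_1'[of "{0<..}" g g' f B] der inj img fB fabs
    by (auto simp: has_integral_iff)
  \<comment> \<open>The two factors of \<open>f (g t)\<close> contribute w^(1 - s/2) and w^(s/2),
    where w = t^2 + k^2. Together they give w, which leaves a single w in the denominator against
    the w^2 of \<open>g'\<close>.\<close>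
  have eq: "\<bar>g' t\<bar> * f (g t) = (2 * k powr (2 - s)) * (t powr (s - 1) / (t\<^sup>2 + k\<^sup>2))" if "t > 0" for t
  proof -
    let ?w = "t\<^sup>2 + k\<^sup>2"
    have w: "?w > 0" by (rule pos)
    have "?w / ?w = 1" using w by (metis divide_self less_irrefl)
    then have g1: "1 - g t = k\<^sup>2 / ?w"
      by (metis g_def add_diff_cancel_left' diff_divide_distrib)
    have sq: "x\<^sup>2 powr y = x powr (2 * y)" if "x > 0" for x y :: real
      using that powr_powr[of x 2 y] by simp
    have "f (g t) = (t powr (s - 2) / ?w powr (s / 2 - 1)) * (k powr (- s) / ?w powr (- s / 2))"
      unfolding f_def g1 using that k w
      by (simp add: g_def powr_divide sq algebra_simps)
    also have "\<dots> = t powr (s - 2) * k powr (- s) / (?w powr (s / 2 - 1) * ?w powr (- s / 2))"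
      by simp
    also have "?w powr (s / 2 - 1) * ?w powr (- s / 2) = 1 / ?w"
    proof -
      have e: "(s / 2 - 1) + (- s / 2) = - 1" by simp
      show ?thesis
        using w unfolding powr_add[symmetric] e by (rule powr_neg_one)
    qed
    finally have f: "f (g t) = t powr (s - 2) * k powr (- s) * ?w" by simp
    have t1: "t powr (s - 1) = t powr (s - 2) * t"
      using that powr_add[of t "s - 2" 1] by simp
    have k1: "k powr (2 - s) = k powr (- s) * k\<^sup>2"
      using k powr_add[of k "- s" 2] by simp
    have "\<bar>g' t\<bar> = 2 * t * k\<^sup>2 / ?w\<^sup>2" using that by (simp add: g'_def)
    moreover have "2 * t * k\<^sup>2 / w\<^sup>2 * (t powr (s - 2) * k powr (- s) * w) =
        (2 * (k powr (- s) * k\<^sup>2)) * (t powr (s - 2) * t / w)" if "w > 0" for w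
      using that by (simp add: field_simps power2_eq_square)
    ultimately show ?thesis
      unfolding f t1 k1 using w by simp
  qed
  have kp: "2 * k powr (2 - s) > 0" using k by simp
  let ?h = "\<lambda>t. t powr (s - 1) / (t\<^sup>2 + k\<^sup>2)"
  have "(\<lambda>t. (2 * k powr (2 - s)) * ?h t) absolutely_integrable_on {0<..}"
    using sub by (subst set_integrable_cong[OF refl refl eq[symmetric]]) auto
  then have habs: "?h absolutely_integrable_on {0<..}"
    using kp by (subst (asm) set_integrable_mult_right_iff) auto
  then show int: "set_integrable lborel {0<..} ?h"
    by (subst set_integrable_lborel_iff) auto
  have "2 * k powr (2 - s) * integral {0<..} ?h = integral {0<..} (\<lambda>t. (2 * k powr (2 - s)) * ?h t)"
    by (rule integral_mult_right[symmetric])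
  also have "\<dots> = B"
    using sub integral_cong[of "{0<..}" "\<lambda>t. \<bar>g' t\<bar> * f (g t)" "\<lambda>t. (2 * k powr (2 - s)) * ?h t"] eq
    by (metis greaterThan_iff)
  also have "B = pi / sin (pi * (s / 2))"
  proof -
    have "complex_of_real (Gamma (s / 2) * Gamma (1 - s / 2)) =
        Gamma (of_real (s / 2)) * Gamma (of_real (1 - s / 2))"
      by (simp only: of_real_mult Gamma_complex_of_real)
    also have "\<dots> = of_real pi / sin (of_real pi * of_real (s / 2))"
      using Gamma_reflection_complex[of "of_real (s / 2)"] by (simp only: of_real_diff of_real_1)
    also have "\<dots> = of_real (pi / sin (pi * (s / 2)))"
      using sin_of_real[of "pi * (s / 2)", where ?'a = complex] by (metis of_real_divide of_real_mult)
    finally have "Gamma (s / 2) * Gamma (1 - s / 2) = pi / sin (pi * (s / 2))"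
      by (simp only: of_real_eq_iff)
    then show ?thesis
      unfolding B_def Beta_def by simp
  qed
  finally have "integral {0<..} ?h * (2 * k powr (2 - s)) = pi / sin (pi * (s / 2))"
    by (simp only: mult.commute)
  then have "integral {0<..} ?h = pi / sin (pi * (s / 2)) / (2 * k powr (2 - s))"
    by (rule eq_divide_imp[rotated]) (use k in simp)
  also have "\<dots> = k powr (s - 2) * (pi / (2 * sin (pi * s / 2)))"
  proof -
    have e: "k powr (s - 2) = 1 / k powr (2 - s)"
      using powr_minus_divide[of k "2 - s"] by simp
    show ?thesis unfolding e by simp
  qed
  finally show "(LINT t:{0<..}|lborel. ?h t) = k powr (s - 2) * (pi / (2 * sin (pi * s / 2)))"
    using set_borel_integral_eq_integral(2)[OF int] by simp
qed

section \<open>Laplace transforms of powers of the sine\<close>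

text \<open>These are the d_k of the overview. For odd b the Laplace transform of sin(kx) supplies
  the factor k. For even b one writes t/(t^2 + k^2) = (1 - k^2/(t^2 + k^2))/t; the terms 1/t cancel
  against the constant Fourier term and the factor -k^2 remains.\<close>

definition partial_coeff :: "nat \<Rightarrow> nat \<Rightarrow> real" where
  "partial_coeff b k = (if even b then - sin_power_coeff b k * real k ^ 2 else sin_power_coeff b k * real k)"

definition partial_sum :: "nat \<Rightarrow> real \<Rightarrow> real" where
  "partial_sum b t = (\<Sum>k=1..b. partial_coeff b k / (t\<^sup>2 + (real k)\<^sup>2))"

lemma sin_power_coeff_parity: "sin_power_coeff b k \<noteq> 0 \<Longrightarrow> k \<le> b \<Longrightarrow> even k = even b"
  by (auto simp: sin_power_coeff_def t_coeff_def minus_one_power_iff split: if_splits)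

text \<open>At a multiple of pi the sine in the antiderivative vanishes. Oddness of k makes the
  cosine there (-1)^N, a sign independent of k, so that all frequencies share one boundary
  factor.\<close>

lemma has_integral_sin_exp:
  fixes t :: real
  assumes "t > 0" "odd k"
  shows "((\<lambda>x. sin (real k * x) * exp (- (x * t))) has_integral
    real k / (t\<^sup>2 + (real k)\<^sup>2) * (1 - (-1) ^ N * exp (- (real N * pi * t)))) {0..real N * pi}"
proof -
  \<comment> \<open>The imaginary part of e^((ik - t)x)/(ik - t).\<close>
  define F where "F x = - exp (- (x * t)) * (t * sin (real k * x) + real k * cos (real k * x)) / (t\<^sup>2 + (real k)\<^sup>2)" for x
  have nz: "t\<^sup>2 + (real k)\<^sup>2 \<noteq> 0" using assms by (simp add: sum_power2_eq_zero_iff)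
  have "(F has_real_derivative sin (real k * x) * exp (- (x * t))) (at x within S)" for x S
    unfolding F_def using nz
    by (auto intro!: derivative_eq_intros simp: divide_simps) (simp_all add: algebra_simps power2_eq_square)
  then have "((\<lambda>x. sin (real k * x) * exp (- (x * t))) has_integral F (real N * pi) - F 0) {0..real N * pi}"
    by (intro fundamental_theorem_of_calculus) (auto simp: has_real_derivative_iff_has_vector_derivative)
  moreover have "sin (real k * (real N * pi)) = 0" "cos (real k * (real N * pi)) = (-1) ^ N"
    using \<open>odd k\<close> sin_npi[of "k * N"] cos_npi[of "k * N"]
    by (simp_all add: mult.assoc power_mult)
  ultimately show ?thesis
    by (simp add: F_def diff_divide_distrib right_diff_distrib mult_ac)
qed

lemma has_integral_cos_exp:
  fixes t :: real
  assumes "t > 0" "even k"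
  shows "((\<lambda>x. cos (real k * x) * exp (- (x * t))) has_integral
    t / (t\<^sup>2 + (real k)\<^sup>2) * (1 - exp (- (real N * pi * t)))) {0..real N * pi}"
proof -
  define F where "F x = exp (- (x * t)) * (real k * sin (real k * x) - t * cos (real k * x)) / (t\<^sup>2 + (real k)\<^sup>2)" for x
  have nz: "t\<^sup>2 + (real k)\<^sup>2 \<noteq> 0" using assms by (simp add: sum_power2_eq_zero_iff)
  have "(F has_real_derivative cos (real k * x) * exp (- (x * t))) (at x within S)" for x S
    unfolding F_def using nz
    by (auto intro!: derivative_eq_intros simp: divide_simps) (simp_all add: algebra_simps power2_eq_square)
  then have "((\<lambda>x. cos (real k * x) * exp (- (x * t))) has_integral F (real N * pi) - F 0) {0..real N * pi}"
    by (intro fundamental_theorem_of_calculus) (auto simp: has_real_derivative_iff_has_vector_derivative)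
  moreover have "sin (real k * (real N * pi)) = 0" "cos (real k * (real N * pi)) = 1"
    using \<open>even k\<close> sin_npi[of "k * N"] cos_npi[of "k * N"]
    by (simp_all add: mult.assoc power_mult)
  ultimately show ?thesis
    by (simp add: F_def diff_divide_distrib right_diff_distrib mult_ac)
qed

text \<open>Termwise integration of the Fourier expansion. Every frequency with nonzero coefficient
  has the parity of b, so the boundary factor is common to all terms.\<close>

lemma sin_power_laplace:
  fixes t :: real
  assumes b: "b \<ge> 1" and t: "t > 0"
  shows "((\<lambda>x. sin x ^ b * exp (- (x * t))) has_integral
    partial_sum b t / (if even b then t else 1) * (1 - (-1) ^ (b * N) * exp (- (real N * pi * t)))) {0..real N * pi}"
proof (cases "even b")
  case False
  let ?E = "1 - (-1) ^ N * exp (- (real N * pi * t))"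
  have "((\<lambda>x. \<Sum>k=1..b. sin_power_coeff b k * (sin (real k * x) * exp (- (x * t)))) has_integral
      (\<Sum>k=1..b. sin_power_coeff b k * (real k / (t\<^sup>2 + (real k)\<^sup>2) * ?E))) {0..real N * pi}"
  proof (intro has_integral_sum finite_atLeastAtMost)
    fix k assume k: "k \<in> {1..b}"
    show "((\<lambda>x. sin_power_coeff b k * (sin (real k * x) * exp (- (x * t)))) has_integral
      sin_power_coeff b k * (real k / (t\<^sup>2 + (real k)\<^sup>2) * ?E)) {0..real N * pi}"
    proof (cases "sin_power_coeff b k = 0")
      case nz: False
      show ?thesis
        using sin_power_coeff_parity[OF nz] k False t
        by (intro has_integral_mult_right has_integral_sin_exp) auto
    qed simp
  qed
  moreover have "(\<Sum>k=1..b. sin_power_coeff b k * (sin (real k * x) * exp (- (x * t)))) = sin x ^ b * exp (- (x * t))" for x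
    using False by (simp add: sin_power_fourier[OF b] sum_distrib_right mult.assoc)
  moreover have "(\<Sum>k=1..b. sin_power_coeff b k * (real k / (t\<^sup>2 + (real k)\<^sup>2) * ?E)) = partial_sum b t * ?E"
    using False by (simp add: partial_sum_def partial_coeff_def sum_distrib_right mult.assoc)
  moreover have "(-1 :: real) ^ (b * N) = (-1) ^ N"
    using False by (simp add: power_mult)
  ultimately show ?thesis using False by simp
next
  case True
  let ?E = "1 - exp (- (real N * pi * t))"
  define c0 where "c0 = real (b choose (b div 2)) / 2 ^ b"
  \<comment> \<open>The Fourier expansion at x = 0, where sin^b vanishes. This identity later
    removes the terms in 1/t.\<close>
  have c0: "c0 + (\<Sum>k=1..b. sin_power_coeff b k) = 0"
    using sin_power_fourier[OF b, of 0] b True by (simp add: c0_def power_0_left)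
  \<comment> \<open>The constant term is written with frequency 0, so that the cosine formula covers
    it too.\<close>
  have "((\<lambda>x. c0 * (cos (real 0 * x) * exp (- (x * t))) +
      (\<Sum>k=1..b. sin_power_coeff b k * (cos (real k * x) * exp (- (x * t))))) has_integral
      c0 * (t / (t\<^sup>2 + (real 0)\<^sup>2) * ?E) + (\<Sum>k=1..b. sin_power_coeff b k * (t / (t\<^sup>2 + (real k)\<^sup>2) * ?E))) {0..real N * pi}"
  proof (intro has_integral_add has_integral_sum finite_atLeastAtMost)
    show "((\<lambda>x. c0 * (cos (real 0 * x) * exp (- (x * t)))) has_integral
      c0 * (t / (t\<^sup>2 + (real 0)\<^sup>2) * ?E)) {0..real N * pi}"
      using t by (intro has_integral_mult_right has_integral_cos_exp) auto
    fix k assume k: "k \<in> {1..b}"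
    show "((\<lambda>x. sin_power_coeff b k * (cos (real k * x) * exp (- (x * t)))) has_integral
      sin_power_coeff b k * (t / (t\<^sup>2 + (real k)\<^sup>2) * ?E)) {0..real N * pi}"
    proof (cases "sin_power_coeff b k = 0")
      case nz: False
      show ?thesis
        using sin_power_coeff_parity[OF nz] k True t
        by (intro has_integral_mult_right has_integral_cos_exp) auto
    qed simp
  qed
  moreover have "c0 * (cos (real 0 * x) * exp (- (x * t))) +
      (\<Sum>k=1..b. sin_power_coeff b k * (cos (real k * x) * exp (- (x * t)))) = sin x ^ b * exp (- (x * t))" for x
    using True by (simp add: sin_power_fourier[OF b] sum_distrib_right mult.assoc distrib_right c0_def)
  moreover have "c0 * (t / (t\<^sup>2 + (real 0)\<^sup>2) * ?E) + (\<Sum>k=1..b. sin_power_coeff b k * (t / (t\<^sup>2 + (real k)\<^sup>2) * ?E)) =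
    partial_sum b t / t * ?E"
  proof -
    have "sin_power_coeff b k * (t / (t\<^sup>2 + (real k)\<^sup>2)) = sin_power_coeff b k / t + partial_coeff b k / (t\<^sup>2 + (real k)\<^sup>2) / t" for k
    proof -
      have "t\<^sup>2 + (real k)\<^sup>2 \<noteq> 0" using t by (simp add: sum_power2_eq_zero_iff)
      then show ?thesis
        using t True by (simp add: partial_coeff_def divide_simps) (simp add: algebra_simps power2_eq_square)
    qed
    then have "(\<Sum>k=1..b. sin_power_coeff b k * (t / (t\<^sup>2 + (real k)\<^sup>2))) = (\<Sum>k=1..b. sin_power_coeff b k) / t + partial_sum b t / t"
      by (simp add: sum.distrib sum_divide_distrib partial_sum_def)
    moreover have "c0 * (t / (t\<^sup>2 + (real 0)\<^sup>2)) = c0 / t"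
      using t by (simp add: power2_eq_square)
    ultimately have "c0 * (t / (t\<^sup>2 + (real 0)\<^sup>2)) + (\<Sum>k=1..b. sin_power_coeff b k * (t / (t\<^sup>2 + (real k)\<^sup>2))) =
      (c0 + (\<Sum>k=1..b. sin_power_coeff b k)) / t + partial_sum b t / t"
      by (simp add: add_divide_distrib)
    then have *: "c0 * (t / (t\<^sup>2 + (real 0)\<^sup>2)) + (\<Sum>k=1..b. sin_power_coeff b k * (t / (t\<^sup>2 + (real k)\<^sup>2))) = partial_sum b t / t"
      unfolding c0 by simp
    show ?thesis
      unfolding *[symmetric] distrib_right sum_distrib_right by (simp add: mult.assoc)
  qed
  moreover have "(-1 :: real) ^ (b * N) = 1"
    using True by (simp add: power_mult)
  ultimately show ?thesis using True by simp
qed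

section \<open>Mellin transforms of decaying partial fractions\<close>

lemma set_integrable_finite_sum:
  fixes f :: "'i \<Rightarrow> 'a \<Rightarrow> real"
  assumes "\<And>i. i \<in> I \<Longrightarrow> set_integrable M A (f i)"
  shows "set_integrable M A (\<lambda>x. \<Sum>i\<in>I. f i x)"
  using assms unfolding set_integrable_def scaleR_sum_right by (rule Bochner_Integration.integrable_sum)

lemma set_integral_finite_sum:
  fixes f :: "'i \<Rightarrow> 'a \<Rightarrow> real"
  assumes "\<And>i. i \<in> I \<Longrightarrow> set_integrable M A (f i)"
  shows "(LINT x:A|M. (\<Sum>i\<in>I. f i x)) = (\<Sum>i\<in>I. LINT x:A|M. f i x)"
  using assms unfolding set_integrable_def set_lebesgue_integral_def scaleR_sum_right
  by (rule Bochner_Integration.integral_sum)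

lemma power_div_fact_le_exp:
  fixes x :: real
  assumes "x \<ge> 0"
  shows "x ^ n / fact n \<le> exp x"
proof -
  have "(\<Sum>k\<in>{n}. inverse (fact k) *\<^sub>R x ^ k) \<le> (\<Sum>k. inverse (fact k) *\<^sub>R x ^ k)"
    using assms by (intro sum_le_suminf summable_exp_generic) auto
  then show ?thesis by (simp add: exp_def divide_inverse mult.commute)
qed

text \<open>Decay forces the moments \<open>\<Sum>k\<in>K. d k * (- (r k)\<^sup>2) ^ j\<close> with \<open>j < m\<close> to vanish.\<close>

lemma partial_fractions_times_power:
  fixes d r :: "'i \<Rightarrow> real"
  assumes "finite K" and r: "\<And>k. k \<in> K \<Longrightarrow> r k > 0"
    and "((\<lambda>t. t ^ (2 * m) * (\<Sum>k\<in>K. d k / (t\<^sup>2 + (r k)\<^sup>2))) \<longlongrightarrow> 0) at_top"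
  shows "t ^ (2 * m) * (\<Sum>k\<in>K. d k / (t\<^sup>2 + (r k)\<^sup>2)) = (\<Sum>k\<in>K. d k * (- (r k)\<^sup>2) ^ m / (t\<^sup>2 + (r k)\<^sup>2))"
  using assms(3)
proof (induction m arbitrary: t)
  case 0
  then show ?case by simp
next
  case (Suc m)
  let ?M = "\<lambda>t. \<Sum>k\<in>K. d k / (t\<^sup>2 + (r k)\<^sup>2)"
  let ?N = "\<lambda>m t. \<Sum>k\<in>K. d k * (- (r k)\<^sup>2) ^ m / (t\<^sup>2 + (r k)\<^sup>2)"
  define S where "S = (\<Sum>k\<in>K. d k * (- (r k)\<^sup>2) ^ m)"
  \<comment> \<open>Dividing by t^2 turns decay at order 2(m + 1) into decay at order 2m, as the
    induction hypothesis requires.\<close>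
  have quot: "((\<lambda>t. (t ^ (2 * Suc m) * ?M t) * inverse (t ^ 2)) \<longlongrightarrow> 0 * 0) at_top"
    by (intro tendsto_mult Suc.prems tendsto_inverse_0_at_top filterlim_pow_at_top filterlim_ident) auto
  have "\<forall>\<^sub>F t in at_top. (t ^ (2 * Suc m) * ?M t) * inverse (t ^ 2) = t ^ (2 * m) * ?M t"
    using eventually_gt_at_top[of 0]
    by eventually_elim (simp add: power2_eq_square field_simps)
  from Lim_transform_eventually[OF quot this]
  have "((\<lambda>t. t ^ (2 * m) * ?M t) \<longlongrightarrow> 0) at_top"
    by simp
  note IH = Suc.IH[OF this]
  \<comment> \<open>By t^2/(t^2 + r^2) = 1 - r^2/(t^2 + r^2), one more factor t^2 splits off the
    constant moment \<open>S\<close>. Both the left side and the remaining fractions tend to 0,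
    hence \<open>S\<close> is 0.\<close>
  have step: "t ^ (2 * Suc m) * ?M t = S + ?N (Suc m) t" for t
  proof -
    have "t ^ (2 * Suc m) * ?M t = t\<^sup>2 * (t ^ (2 * m) * ?M t)"
      by (simp add: power2_eq_square mult_ac)
    also have "\<dots> = (\<Sum>k\<in>K. d k * (- (r k)\<^sup>2) ^ m + d k * (- (r k)\<^sup>2) ^ Suc m / (t\<^sup>2 + (r k)\<^sup>2))"
      unfolding IH
      unfolding sum_distrib_left
    proof (rule sum.cong)
      fix k assume "k \<in> K"
      then have "t\<^sup>2 + (r k)\<^sup>2 \<noteq> 0" using r[of k] by (simp add: sum_power2_eq_zero_iff)
      then show "t\<^sup>2 * (d k * (- (r k)\<^sup>2) ^ m / (t\<^sup>2 + (r k)\<^sup>2)) =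
        d k * (- (r k)\<^sup>2) ^ m + d k * (- (r k)\<^sup>2) ^ Suc m / (t\<^sup>2 + (r k)\<^sup>2)"
        by (simp add: divide_simps del: sum_power2_eq_zero_iff) (simp add: algebra_simps)
    qed simp
    finally show ?thesis unfolding S_def by (simp only: sum.distrib)
  qed
  have "((\<lambda>t. d k * (- (r k)\<^sup>2) ^ Suc m / (t\<^sup>2 + (r k)\<^sup>2)) \<longlongrightarrow> 0) at_top" for k
  proof -
    have "filterlim (\<lambda>t. (r k)\<^sup>2 + t\<^sup>2) at_top at_top"
      by (intro filterlim_tendsto_add_at_top[OF tendsto_const] filterlim_pow_at_top filterlim_ident) simp
    then show ?thesis
      unfolding add.commute[of _ "(r k)\<^sup>2"]
      by (intro tendsto_divide_0[OF tendsto_const filterlim_at_top_imp_at_infinity])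
  qed
  then have "(?N (Suc m) \<longlongrightarrow> 0) at_top"
    using tendsto_sum[of K "\<lambda>k t. d k * (- (r k)\<^sup>2) ^ Suc m / (t\<^sup>2 + (r k)\<^sup>2)" "\<lambda>_. 0" at_top] by simp
  then have "((\<lambda>t. S + ?N (Suc m) t) \<longlongrightarrow> S + 0) at_top"
    by (intro tendsto_intros)
  moreover have "((\<lambda>t. S + ?N (Suc m) t) \<longlongrightarrow> 0) at_top"
    using Suc.prems unfolding step .
  ultimately have "S = 0"
    using tendsto_unique[OF trivial_limit_at_top_linorder] by fastforce
  then show ?case using step by simp
qed

text \<open>Absorbing t^(2m) into the fractions lowers the exponent to s = \<beta> - 2m in (0,2),
  where each summand is integrable by itself. The resulting formula has the same shape for every
  m.\<close>

lemma Mellin_partial_fractions: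
  fixes d r :: "'i \<Rightarrow> real"
  assumes K: "finite K" and r: "\<And>k. k \<in> K \<Longrightarrow> r k > 0"
    and lim: "((\<lambda>t. t ^ (2 * m) * (\<Sum>k\<in>K. d k / (t\<^sup>2 + (r k)\<^sup>2))) \<longlongrightarrow> 0) at_top"
    and \<beta>: "2 * real m < \<beta>" "\<beta> < 2 * real m + 2"
  shows "set_integrable lborel {0<..} (\<lambda>t. t powr (\<beta> - 1) * (\<Sum>k\<in>K. d k / (t\<^sup>2 + (r k)\<^sup>2)))"
    and "(LINT t:{0<..}|lborel. t powr (\<beta> - 1) * (\<Sum>k\<in>K. d k / (t\<^sup>2 + (r k)\<^sup>2))) =
      (\<Sum>k\<in>K. d k * r k powr (\<beta> - 2)) * (pi / (2 * sin (pi * \<beta> / 2)))"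
proof -
  define s where "s = \<beta> - 2 * real m"
  have s: "0 < s" "s < 2" using \<beta> by (auto simp: s_def)
  let ?f = "\<lambda>t. t powr (\<beta> - 1) * (\<Sum>k\<in>K. d k / (t\<^sup>2 + (r k)\<^sup>2))"
  let ?g = "\<lambda>t. \<Sum>k\<in>K. (d k * (- (r k)\<^sup>2) ^ m) * (t powr (s - 1) / (t\<^sup>2 + (r k)\<^sup>2))"
  have eq: "?f t = ?g t" if "t > 0" for t
  proof -
    have "t powr (\<beta> - 1) = t powr (s - 1) * t ^ (2 * m)"
      using that by (simp add: s_def powr_add[symmetric] powr_realpow[symmetric])
    then have "?f t = t powr (s - 1) * (t ^ (2 * m) * (\<Sum>k\<in>K. d k / (t\<^sup>2 + (r k)\<^sup>2)))"
      by (simp add: mult.assoc)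
    also have "\<dots> = ?g t"
      by (simp only: partial_fractions_times_power[OF K r lim]) (simp add: sum_distrib_left mult_ac)
    finally show ?thesis .
  qed
  have ig: "set_integrable lborel {0<..} ?g"
    by (intro set_integrable_finite_sum set_integrable_mult_right Mellin_inverse_square s r) auto
  then show "set_integrable lborel {0<..} ?f"
    by (subst set_integrable_cong[OF refl refl eq]) auto
  have "(LINT t:{0<..}|lborel. ?f t) = (LINT t:{0<..}|lborel. ?g t)"
    by (intro set_lebesgue_integral_cong) (auto simp: eq)
  also have "\<dots> = (\<Sum>k\<in>K. (d k * (- (r k)\<^sup>2) ^ m) * (r k powr (s - 2) * (pi / (2 * sin (pi * s / 2)))))"
  proof (subst set_integral_finite_sum)
    show "set_integrable lborel {0<..} (\<lambda>t. (d k * (- (r k)\<^sup>2) ^ m) * (t powr (s - 1) / (t\<^sup>2 + (r k)\<^sup>2)))"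
      if "k \<in> K" for k
      by (intro set_integrable_mult_right Mellin_inverse_square s r that)
    show "(\<Sum>k\<in>K. LINT t:{0<..}|lborel. (d k * (- (r k)\<^sup>2) ^ m) * (t powr (s - 1) / (t\<^sup>2 + (r k)\<^sup>2))) =
        (\<Sum>k\<in>K. (d k * (- (r k)\<^sup>2) ^ m) * (r k powr (s - 2) * (pi / (2 * sin (pi * s / 2)))))"
      by (intro sum.cong refl) (simp only: set_integral_mult_right Mellin_inverse_square(2)[OF s r])
  qed
  also have "\<dots> = (\<Sum>k\<in>K. d k * r k powr (\<beta> - 2)) * (pi / (2 * sin (pi * \<beta> / 2)))"
    unfolding sum_distrib_right
  proof (rule sum.cong)
    fix k assume "k \<in> K"
    then have "r k > 0" by (rule r)
    then have "(r k)\<^sup>2 ^ m = r k powr (2 * real m)"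
      using powr_realpow[of "r k" "2 * m"] by (simp add: power_mult)
    then have p: "r k powr (\<beta> - 2) = r k powr (s - 2) * (r k)\<^sup>2 ^ m"
      using powr_add[of "r k" "s - 2" "2 * real m"] by (simp add: s_def)
    \<comment> \<open>Shifting the sine by m pi gives the sign (-1)^m, which cancels the sign of
      (-r^2)^m.\<close>
    have "pi * \<beta> / 2 = pi * s / 2 + real m * pi"
      by (simp add: s_def field_simps)
    then have "sin (pi * \<beta> / 2) = (-1) ^ m * sin (pi * s / 2)"
      by (simp only: sin_add sin_npi cos_npi) simp
    then show "(d k * (- (r k)\<^sup>2) ^ m) * (r k powr (s - 2) * (pi / (2 * sin (pi * s / 2)))) =
      d k * r k powr (\<beta> - 2) * (pi / (2 * sin (pi * \<beta> / 2)))"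
      unfolding p by (subst power_minus) (cases "even m"; simp add: mult_ac)
  qed simp
  finally show "(LINT t:{0<..}|lborel. ?f t) = (\<Sum>k\<in>K. d k * r k powr (\<beta> - 2)) * (pi / (2 * sin (pi * \<beta> / 2)))" .
qed

section \<open>Positivity, decay and Mellin transform of \<open>partial_sum\<close>\<close>

lemma partial_sum_nonneg:
  assumes b: "b \<ge> 1" and t: "t > 0"
  shows "partial_sum b t \<ge> 0"
proof -
  let ?E = "1 - (-1) ^ b * exp (- (pi * t))"
  \<comment> \<open>A single half-wave (N = 1) suffices: the sine is nonnegative on [0, pi], and the
    boundary factor is positive.\<close>
  have I: "((\<lambda>x. sin x ^ b * exp (- (x * t))) has_integral
    partial_sum b t / (if even b then t else 1) * ?E) {0..pi}"
    using sin_power_laplace[OF b t, of 1] by simp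
  have "partial_sum b t / (if even b then t else 1) * ?E \<ge> 0"
    by (rule has_integral_nonneg[OF I]) (auto intro!: mult_nonneg_nonneg zero_le_power sin_ge_zero)
  moreover have "?E > 0"
    using t by (cases "even b") (auto intro: add_pos_pos)
  ultimately show ?thesis
    using t by (auto simp: zero_le_mult_iff zero_le_divide_iff split: if_splits)
qed

text \<open>On [0, pi] the bounds sin x \<le> x and (xt)^b/b! \<le> e^(xt) give an integrand of at
  most b!/t^b. For t \<ge> 1 the boundary factor is at least 1 - e^(-pi).\<close>

lemma partial_sum_bound:
  assumes b: "b \<ge> 1" and t: "t \<ge> 1"
  shows "t ^ b * (partial_sum b t / (if even b then t else 1)) \<le> pi * fact b / (1 - exp (- pi))"
proof -
  let ?E = "1 - (-1) ^ b * exp (- (pi * t))"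
  let ?L = "partial_sum b t / (if even b then t else 1)"
  have "t > 0" using t by simp
  have L: "?L \<ge> 0"
    using partial_sum_nonneg[OF b \<open>t > 0\<close>] t by simp
  have I: "((\<lambda>x. sin x ^ b * exp (- (x * t))) has_integral ?L * ?E) {0..pi}"
    using sin_power_laplace[OF b \<open>t > 0\<close>, of 1] by simp
  have "sin x ^ b * exp (- (x * t)) \<le> fact b / t ^ b" if x: "x \<in> {0..pi}" for x
  proof -
    have "(x * t) ^ b / fact b \<le> exp (x * t)"
      using power_div_fact_le_exp[of "x * t" b] x t by simp
    then have "x ^ b * exp (- (x * t)) \<le> fact b / t ^ b"
      using t by (simp add: power_mult_distrib exp_minus field_simps)
    moreover have "sin x ^ b \<le> x ^ b"
      using x by (intro power_mono sin_x_le_x sin_ge_zero) auto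
    ultimately show ?thesis
      by (meson exp_ge_zero mult_right_mono order_trans)
  qed
  then have "?L * ?E \<le> fact b / t ^ b * pi"
    using has_integral_le[OF I has_integral_const_real[of "fact b / t ^ b" 0 pi]] by (simp add: mult.commute)
  moreover have "?L * (1 - exp (- pi)) \<le> ?L * ?E"
  proof (intro mult_left_mono L)
    have "exp (- (pi * t)) \<le> exp (- pi)" using t by simp
    moreover have "(-1) ^ b * exp (- (pi * t)) \<le> exp (- (pi * t))"
      by (cases "even b") (auto intro: order_trans[of _ 0])
    ultimately show "1 - exp (- pi) \<le> ?E" by linarith
  qed
  ultimately have "?L * (1 - exp (- pi)) \<le> fact b / t ^ b * pi" by simp
  then have "t ^ b * (?L * (1 - exp (- pi))) \<le> t ^ b * (fact b / t ^ b * pi)"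
    using t by (intro mult_left_mono) auto
  then show ?thesis
    using t by (simp add: field_simps)
qed

text \<open>The power of t that divides \<open>partial_sum\<close> in the Laplace transform. The
  Mellin exponent \<beta> of the overview is a minus this number.\<close>

definition parity_shift :: "nat \<Rightarrow> nat" where
  "parity_shift b = (if even b then 1 else 0)"

lemma partial_sum_times_power_tendsto_0:
  assumes b: "b \<ge> 1" and m: "2 * m + parity_shift b < b + 1"
  shows "((\<lambda>t. t ^ (2 * m) * partial_sum b t) \<longlongrightarrow> 0) at_top"
proof (rule real_tendsto_sandwich)
  let ?C = "pi * fact b / (1 - exp (- pi))"
  show "\<forall>\<^sub>F t in at_top. 0 \<le> t ^ (2 * m) * partial_sum b t"
    using eventually_gt_at_top[of 0] by eventually_elim (simp add: partial_sum_nonneg[OF b])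
  \<comment> \<open>The numbers 2m + \<open>parity_shift b\<close> and b have opposite parity, so
    the strict bound by b + 1 improves by one. The spare power of t yields the majorant C/t.\<close>
  have m': "Suc (2 * m + parity_shift b) \<le> b"
    using m by (auto simp: parity_shift_def split: if_splits) presburger+
  show "\<forall>\<^sub>F t in at_top. t ^ (2 * m) * partial_sum b t \<le> ?C * inverse t"
    using eventually_ge_at_top[of 1]
  proof eventually_elim
    case (elim t)
    let ?L = "partial_sum b t / (if even b then t else 1)"
    have "?L \<ge> 0" using partial_sum_nonneg[OF b, of t] elim by simp
    have "t * (t ^ (2 * m) * partial_sum b t) = t ^ Suc (2 * m + parity_shift b) * ?L"
      using elim by (simp add: parity_shift_def)
    also have "\<dots> \<le> t ^ b * ?L"
      using m' elim \<open>?L \<ge> 0\<close> by (intro mult_right_mono power_increasing) auto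
    also have "\<dots> \<le> ?C" by (rule partial_sum_bound[OF b elim])
    finally show ?case using elim by (simp add: field_simps)
  qed
  show "((\<lambda>t. ?C * inverse t) \<longlongrightarrow> 0) at_top"
    using tendsto_mult[OF tendsto_const tendsto_inverse_0_at_top[OF filterlim_ident], of ?C] by simp
qed simp

text \<open>With m the integer part of \<beta>/2, the nonvanishing sine excludes \<beta> = 2m, so
  \<beta> lies strictly between 2m and 2m + 2. The upper bound on \<beta> keeps m within the range
  of the decay estimate.\<close>

lemma Mellin_partial_sum:
  assumes b: "b \<ge> 1" and \<beta>: "0 < \<beta>" "\<beta> < real (b + 1 - parity_shift b)" and ne: "sin (pi * \<beta> / 2) \<noteq> 0"
  shows "set_integrable lborel {0<..} (\<lambda>t. t powr (\<beta> - 1) * partial_sum b t)"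
    and "(LINT t:{0<..}|lborel. t powr (\<beta> - 1) * partial_sum b t) =
      (\<Sum>k=1..b. partial_coeff b k * real k powr (\<beta> - 2)) * (pi / (2 * sin (pi * \<beta> / 2)))"
proof -
  define m where "m = nat \<lfloor>\<beta> / 2\<rfloor>"
  have m: "real m \<le> \<beta> / 2" "\<beta> / 2 < real m + 1"
    using \<beta> unfolding m_def by (simp_all add: of_nat_nat) linarith+
  have "\<beta> \<noteq> 2 * real m"
  proof
    assume "\<beta> = 2 * real m"
    then have "pi * \<beta> / 2 = real m * pi" by simp
    with ne show False by simp
  qed
  with m have m': "2 * real m < \<beta>" "\<beta> < 2 * real m + 2" by auto
  with \<beta> have "2 * m < b + 1 - parity_shift b" by linarith
  then have lim: "((\<lambda>t. t ^ (2 * m) * (\<Sum>k=1..b. partial_coeff b k / (t\<^sup>2 + (real k)\<^sup>2))) \<longlongrightarrow> 0) at_top"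
    using partial_sum_times_power_tendsto_0[OF b, of m] unfolding partial_sum_def by simp
  show "set_integrable lborel {0<..} (\<lambda>t. t powr (\<beta> - 1) * partial_sum b t)"
    unfolding partial_sum_def by (rule Mellin_partial_fractions(1)[OF _ _ lim m']) auto
  show "(LINT t:{0<..}|lborel. t powr (\<beta> - 1) * partial_sum b t) =
      (\<Sum>k=1..b. partial_coeff b k * real k powr (\<beta> - 2)) * (pi / (2 * sin (pi * \<beta> / 2)))"
    unfolding partial_sum_def by (rule Mellin_partial_fractions(2)[OF _ _ lim m']) auto
qed

section \<open>Interchange of integrals and continuity in the exponent\<close>

text \<open>Euler's integral for Gamma, rescaled by x; it represents x^(-a) as a superposition of
  exponentials.\<close>

lemma Laplace_powr:
  fixes a x :: real
  assumes a: "a > 0" and x: "x > 0"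
  shows "set_integrable lborel {0<..} (\<lambda>t. t powr (a - 1) * exp (- (x * t)))"
    and "(LINT t:{0<..}|lborel. t powr (a - 1) * exp (- (x * t))) = Gamma a / x powr a"
proof -
  let ?h = "\<lambda>t::real. t powr (a - 1) / exp t"
  define f where "f t = indicator {0<..} t *\<^sub>R ?h t" for t :: real
  have "(?h has_integral Gamma a) {0<..}"
    using Gamma_integral_real[OF a]
    by (rule has_integral_spike_set_eq[THEN iffD1, rotated -1])
      (auto intro: negligible_subset[of "{0}"])
  then have habs: "?h absolutely_integrable_on {0<..}"
    by (intro nonnegative_absolutely_integrable_1) (auto simp: has_integral_iff)
  then have hint: "set_integrable lborel {0<..} ?h"
    by (subst set_integrable_lborel_iff) auto
  then have f: "integrable lborel f"
    unfolding f_def[abs_def] set_integrable_def .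
  have "integral {0<..} ?h = Gamma a"
    using \<open>(?h has_integral Gamma a) {0<..}\<close> by (rule integral_unique)
  then have fG: "integral\<^sup>L lborel f = Gamma a"
    using set_borel_integral_eq_integral(2)[OF hint] unfolding f_def[abs_def] set_lebesgue_integral_def by simp
  have eq: "f (0 + x * t) = x powr (a - 1) * (indicator {0<..} t *\<^sub>R (t powr (a - 1) * exp (- (x * t))))" for t
    using x by (cases "t > 0") (auto simp: f_def powr_mult exp_minus field_simps zero_less_mult_iff)
  have "integrable lborel (\<lambda>t. f (0 + x * t))"
    using x by (intro lborel_integrable_real_affine[OF f]) simp
  then have "integrable lborel (\<lambda>t. x powr (a - 1) * (indicator {0<..} t *\<^sub>R (t powr (a - 1) * exp (- (x * t)))))"
    unfolding eq .
  then show "set_integrable lborel {0<..} (\<lambda>t. t powr (a - 1) * exp (- (x * t)))"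
    unfolding set_integrable_def using x by (subst (asm) integrable_mult_left_iff) auto
  have "Gamma a = \<bar>x\<bar> *\<^sub>R integral\<^sup>L lborel (\<lambda>t. f (0 + x * t))"
    using lborel_integral_real_affine[of x f 0] x fG by simp
  also have "\<dots> = x * x powr (a - 1) * (LINT t:{0<..}|lborel. t powr (a - 1) * exp (- (x * t)))"
    using x unfolding eq set_lebesgue_integral_def by simp
  also have "x * x powr (a - 1) = x powr a"
    using x powr_add[of x 1 "a - 1"] by simp
  finally show "(LINT t:{0<..}|lborel. t powr (a - 1) * exp (- (x * t))) = Gamma a / x powr a"
    using x by simp
qed

text \<open>From |sin x| \<le> x one gets the majorant x^(b - a), integrable at 0 because b - a >
  -1.\<close>

lemma sin_power_over_powr_integrable:
  assumes "b \<ge> 1" and "a < real b + 1" and "c \<ge> 0"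
  shows "set_integrable lborel {0..c} (\<lambda>x. sin x ^ b / x powr a)"
proof -
  have "(\<lambda>x. x powr (real b - a)) integrable_on {0..c}"
    using assms by (intro integrable_on_powr_from_0) auto
  then have "(\<lambda>x. x powr (real b - a)) absolutely_integrable_on {0..c}"
    by (intro nonnegative_absolutely_integrable_1) auto
  then have "set_integrable lborel {0..c} (\<lambda>x. x powr (real b - a))"
    by (subst set_integrable_lborel_iff) auto
  then show ?thesis
  proof (rule set_integrable_bound)
    show "set_borel_measurable lborel {0..c} (\<lambda>x. sin x ^ b / x powr a)"
      unfolding set_borel_measurable_def by measurable
    have "\<bar>sin x ^ b / x powr a\<bar> \<le> x powr (real b - a)" if "x > 0" for x
    proof -
      have "\<bar>sin x\<bar> ^ b \<le> x ^ b"
        using that abs_sin_x_le_abs_x[of x] by (intro power_mono) auto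
      also have "x ^ b = x powr real b" using that by (simp add: powr_realpow)
      finally show ?thesis
        using that by (simp add: power_abs powr_diff divide_right_mono)
    qed
    \<comment> \<open>At x = 0 both \<open>0 powr a\<close> and division by zero give 0, so the
      bound holds there as well.\<close>
    then show "AE x in lborel. x \<in> {0..c} \<longrightarrow> norm (sin x ^ b / x powr a) \<le> norm (x powr (real b - a))"
      by (intro AE_I2) (metis atLeastAtMost_iff less_eq_real_def norm_zero div_by_0 norm_ge_zero powr_0 powr_ge_zero real_norm_def abs_of_nonneg powr_zero_eq_one)
  qed
qed

text \<open>The t-integral of the absolute value is Gamma(a) |sin x|^b/x^a, which is integrable on
  [0, c]. The cut at c secures absolute convergence, which fails on the half-line for a \<le>
  1.\<close>

lemma sin_power_Fubini:
  assumes b: "b \<ge> 1" and a: "0 < a" "a < real b + 1" and c: "c \<ge> 0"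
  shows "Gamma a * (LINT x:{0..c}|lborel. sin x ^ b / x powr a) =
    (LINT t:{0<..}|lborel. t powr (a - 1) * (LINT x:{0..c}|lborel. sin x ^ b * exp (- (x * t))))"
proof -
  define f where "f x t = indicator {0..c} x * (sin x ^ b * (indicator {0<..} t * (t powr (a - 1) * exp (- (x * t)))))"
    for x t :: real
  have meas: "case_prod f \<in> borel_measurable (lborel \<Otimes>\<^sub>M lborel)"
    unfolding f_def by measurable
  have int_t: "integrable lborel (f x)" and eq_t: "integral\<^sup>L lborel (f x) = Gamma a * (indicator {0..c} x * (sin x ^ b / x powr a))"
    and norm_t: "(LINT t|lborel. norm (f x t)) = Gamma a * \<bar>indicator {0..c} x * (sin x ^ b / x powr a)\<bar>" for x
  proof -
    have "integrable lborel (f x) \<and> integral\<^sup>L lborel (f x) = Gamma a * (indicator {0..c} x * (sin x ^ b / x powr a)) \<and>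
      (LINT t|lborel. norm (f x t)) = Gamma a * \<bar>indicator {0..c} x * (sin x ^ b / x powr a)\<bar>"
    proof (cases "x > 0")
      case True
      have i: "integrable lborel (\<lambda>t. indicator {0<..} t * (t powr (a - 1) * exp (- (x * t))))"
        using Laplace_powr(1)[OF a(1) True] by (simp add: set_integrable_def)
      have e: "(LINT t|lborel. indicator {0<..} t * (t powr (a - 1) * exp (- (x * t)))) = Gamma a / x powr a"
        using Laplace_powr(2)[OF a(1) True] by (simp add: set_lebesgue_integral_def)
      have n: "norm (f x t) = \<bar>indicator {0..c} x * sin x ^ b\<bar> * (indicator {0<..} t * (t powr (a - 1) * exp (- (x * t))))" for t
        by (simp add: f_def abs_mult)
      show ?thesis
        unfolding n unfolding f_def[abs_def] mult.assoc[symmetric, of "indicator {0..c} x"]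
        using i e True by (simp add: abs_mult)
    next
      \<comment> \<open>For x < 0 the indicator is 0; at x = 0 the power of the sine is 0 since b
        \<ge> 1.\<close>
      case False
      then have "f x = (\<lambda>_. 0)" "indicator {0..c} x * (sin x ^ b / x powr a) = 0"
        using b by (auto simp: f_def indicator_def fun_eq_iff)
      then show ?thesis by simp
    qed
    then show "integrable lborel (f x)" "integral\<^sup>L lborel (f x) = Gamma a * (indicator {0..c} x * (sin x ^ b / x powr a))"
      "(LINT t|lborel. norm (f x t)) = Gamma a * \<bar>indicator {0..c} x * (sin x ^ b / x powr a)\<bar>" by auto
  qed
  have g: "integrable lborel (\<lambda>x. indicator {0..c} x * (sin x ^ b / x powr a))"
    using sin_power_over_powr_integrable[OF b a(2) c] by (simp add: set_integrable_def)
  have "integrable (lborel \<Otimes>\<^sub>M lborel) (case_prod f)"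
  proof (rule lborel_pair.Fubini_integrable[OF meas])
    show "integrable lborel (\<lambda>x. LINT y|lborel. norm (case (x, y) of (x, y) \<Rightarrow> f x y))"
      unfolding prod.case norm_t by (intro integrable_mult_right integrable_abs g)
    show "AE x in lborel. integrable lborel (\<lambda>y. case (x, y) of (x, y) \<Rightarrow> f x y)"
      using int_t by (intro AE_I2) simp
  qed
  from lborel_pair.Fubini_integral[OF this]
  have "(LINT t|lborel. LINT x|lborel. f x t) = (LINT x|lborel. integral\<^sup>L lborel (f x))" .
  also have "\<dots> = Gamma a * (LINT x:{0..c}|lborel. sin x ^ b / x powr a)"
    unfolding eq_t set_lebesgue_integral_def by (simp only: real_scaleR_def integral_mult_right_zero)
  also have "(LINT t|lborel. LINT x|lborel. f x t) =
      (LINT t:{0<..}|lborel. t powr (a - 1) * (LINT x:{0..c}|lborel. sin x ^ b * exp (- (x * t))))"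
    unfolding set_lebesgue_integral_def
  proof (rule Bochner_Integration.integral_cong[OF refl])
    fix t :: real
    have "f x t = (indicator {0<..} t * t powr (a - 1)) * (indicator {0..c} x *\<^sub>R (sin x ^ b * exp (- (x * t))))" for x
      by (simp add: f_def)
    then show "(LINT x|lborel. f x t) = indicator {0<..} t *\<^sub>R (t powr (a - 1) * (LINT x|lborel. indicator {0..c} x *\<^sub>R (sin x ^ b * exp (- (x * t)))))"
      by simp
  qed
  finally show ?thesis by simp
qed

section \<open>Non-integral exponents and continuity of the Mellin transform\<close>

lemma eventually_not_Ints_at:
  fixes a :: real
  shows "\<forall>\<^sub>F x in at a. x \<notin> \<int>"
proof -
  \<comment> \<open>The only integer that this open interval can contain is a itself.\<close>
  have "\<forall>\<^sub>F x in at a. real_of_int \<lceil>a\<rceil> - 1 < x \<and> x < real_of_int \<lfloor>a\<rfloor> + 1 \<and> x \<noteq> a"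
    by (intro eventually_conj order_tendstoD[OF tendsto_ident_at] eventually_neq_at_within) linarith+
  then show ?thesis
  proof eventually_elim
    case (elim x)
    show ?case
    proof
      assume "x \<in> \<int>"
      then obtain i where "x = of_int i" by (elim Ints_cases)
      with elim have "\<lceil>a\<rceil> \<le> i" "i \<le> \<lfloor>a\<rfloor>" by linarith+
      then have "a = of_int i" by linarith
      with elim \<open>x = of_int i\<close> show False by simp
    qed
  qed
qed

lemma exists_not_Ints_between:
  fixes u v :: real
  assumes "u < v"
  obtains p where "u < p" "p < v" "p \<notin> \<int>"
proof -
  have "\<forall>\<^sub>F x in at ((u + v) / 2). u < x \<and> x < v \<and> x \<notin> \<int>"
    using assms
    by (intro eventually_conj order_tendstoD[OF tendsto_ident_at] eventually_not_Ints_at) auto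
  then show ?thesis
    using that by (auto dest: eventually_happens)
qed

lemma sin_half_pi_nonzero:
  fixes x :: real
  assumes "x \<notin> \<int>"
  shows "sin (pi * x / 2) \<noteq> 0"
proof
  assume "sin (pi * x / 2) = 0"
  then obtain i where "pi * x / 2 = of_int i * pi"
    by (auto simp: sin_zero_iff_int2)
  then have "x = of_int (2 * i)" by (simp add: field_simps)
  with assms show False by (metis Ints_of_int)
qed

text \<open>For p < s < q one has t^(s-1) \<le> t^(p-1) + t^(q-1), so one integrable majorant serves
  all these s and dominated convergence applies.\<close>

lemma Mellin_continuous:
  fixes M :: "real \<Rightarrow> real"
  assumes M: "M \<in> borel_measurable borel"
    and p: "set_integrable lborel {0<..} (\<lambda>t. t powr (p - 1) * M t)"
    and q: "set_integrable lborel {0<..} (\<lambda>t. t powr (q - 1) * M t)"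
    and \<beta>: "p < \<beta>" "\<beta> < q"
  shows "set_integrable lborel {0<..} (\<lambda>t. t powr (\<beta> - 1) * M t)"
    and "((\<lambda>s. LINT t:{0<..}|lborel. t powr (s - 1) * M t) \<longlongrightarrow>
           (LINT t:{0<..}|lborel. t powr (\<beta> - 1) * M t)) (at \<beta>)"
proof -
  define w where "w t = indicator {0<..} t * (\<bar>t powr (p - 1) * M t\<bar> + \<bar>t powr (q - 1) * M t\<bar>)" for t
  define f where "f s t = indicator {0<..} t *\<^sub>R (t powr (s - 1) * M t)" for s t
  note [measurable] = M
  have w: "integrable lborel w"
    using set_integral_add(1)[OF set_integrable_abs[OF p] set_integrable_abs[OF q]]
    by (simp add: set_integrable_def w_def[abs_def])
  have fm: "f s \<in> borel_measurable lborel" for s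
    unfolding f_def by measurable
  have bound: "norm (f s t) \<le> w t" if "p < s" "s < q" for s t
  proof (cases "t > 0")
    case True
    have "t powr (s - 1) \<le> t powr (p - 1) + t powr (q - 1)"
    proof (cases "t \<ge> 1")
      case True
      then have "t powr (s - 1) \<le> t powr (q - 1)" using that by (intro powr_mono) auto
      then show ?thesis by (simp add: add_increasing)
    next
      case False
      then have "t powr (s - 1) \<le> t powr (p - 1)" using that \<open>t > 0\<close> by (intro powr_mono') auto
      then show ?thesis by (simp add: add_increasing2)
    qed
    then have "t powr (s - 1) * \<bar>M t\<bar> \<le> (t powr (p - 1) + t powr (q - 1)) * \<bar>M t\<bar>"
      by (rule mult_right_mono) simp
    then show ?thesis using True by (simp add: f_def w_def abs_mult distrib_right)
  qed (simp add: f_def w_def)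
  have "integrable lborel (f \<beta>)"
    by (rule Bochner_Integration.integrable_bound[OF w fm])
      (use bound[OF \<beta>] in \<open>auto intro: order_trans[OF _ abs_ge_self]\<close>)
  then show "set_integrable lborel {0<..} (\<lambda>t. t powr (\<beta> - 1) * M t)"
    unfolding set_integrable_def f_def .
  have "((\<lambda>s. integral\<^sup>L lborel (f s)) \<longlongrightarrow> integral\<^sup>L lborel (f \<beta>)) (at \<beta>)"
    unfolding tendsto_at_iff_sequentially comp_def
  proof (intro allI impI)
    fix X assume X: "\<forall>i. X i \<in> UNIV - {\<beta>}" "X \<longlonglongrightarrow> \<beta>"
    have "\<forall>\<^sub>F n in sequentially. p < X n \<and> X n < q"
      using \<beta> by (intro eventually_conj order_tendstoD[OF X(2)])
    \<comment> \<open>The majorant is available only once the sequence has entered (p, q); its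
      initial segment is dropped.\<close>
    then obtain n0 where n0: "\<And>n. n \<ge> n0 \<Longrightarrow> p < X n \<and> X n < q"
      by (auto simp: eventually_sequentially)
    have "(\<lambda>n. integral\<^sup>L lborel (f (X (n + n0)))) \<longlonglongrightarrow> integral\<^sup>L lborel (f \<beta>)"
    proof (rule integral_dominated_convergence[where w = w])
      show "AE t in lborel. (\<lambda>n. f (X (n + n0)) t) \<longlonglongrightarrow> f \<beta> t"
      proof (intro AE_I2)
        fix t
        show "(\<lambda>n. f (X (n + n0)) t) \<longlonglongrightarrow> f \<beta> t"
          using LIMSEQ_ignore_initial_segment[OF X(2), of n0]
          by (cases "t > 0") (auto simp: f_def intro!: tendsto_intros)
      qed
      show "AE t in lborel. norm (f (X (n + n0)) t) \<le> w t" for n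
        using n0[of "n + n0"] by (intro AE_I2 bound) auto
    qed (rule fm w)+
    then show "(\<lambda>n. integral\<^sup>L lborel (f (X n))) \<longlonglongrightarrow> integral\<^sup>L lborel (f \<beta>)"
      by (rule LIMSEQ_offset)
  qed
  then show "((\<lambda>s. LINT t:{0<..}|lborel. t powr (s - 1) * M t) \<longlongrightarrow>
           (LINT t:{0<..}|lborel. t powr (\<beta> - 1) * M t)) (at \<beta>)"
    unfolding set_lebesgue_integral_def f_def .
qed

lemma partial_sum_Mellin_continuous:
  assumes b: "b \<ge> 1" and \<beta>: "0 < \<beta>" "\<beta> < real (b + 1 - parity_shift b)"
  shows "set_integrable lborel {0<..} (\<lambda>t. t powr (\<beta> - 1) * partial_sum b t)"
    and "((\<lambda>s. LINT t:{0<..}|lborel. t powr (s - 1) * partial_sum b t) \<longlongrightarrow>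
           (LINT t:{0<..}|lborel. t powr (\<beta> - 1) * partial_sum b t)) (at \<beta>)"
proof -
  obtain p where p: "0 < p" "p < \<beta>" "p \<notin> \<int>" using exists_not_Ints_between[OF \<beta>(1)] .
  obtain q where q: "\<beta> < q" "q < real (b + 1 - parity_shift b)" "q \<notin> \<int>"
    using exists_not_Ints_between[OF \<beta>(2)] .
  have M: "partial_sum b \<in> borel_measurable borel"
    unfolding partial_sum_def[abs_def] by measurable
  note ip = Mellin_partial_sum(1)[OF b _ _ sin_half_pi_nonzero]
  note C = Mellin_continuous[OF M ip ip p(2) q(1)]
  show "set_integrable lborel {0<..} (\<lambda>t. t powr (\<beta> - 1) * partial_sum b t)"
    by (rule C(1)) (use p q \<beta> in auto)
  show "((\<lambda>s. LINT t:{0<..}|lborel. t powr (s - 1) * partial_sum b t) \<longlongrightarrow>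
           (LINT t:{0<..}|lborel. t powr (\<beta> - 1) * partial_sum b t)) (at \<beta>)"
    by (rule C(2)) (use p q \<beta> in auto)
qed

text \<open>Fubini and the Laplace formula turn the truncated integral into the Mellin integrand
  times a boundary factor. That factor is at most 2 in absolute value and tends to 1, so dominated
  convergence applies.\<close>

lemma sin_power_truncated_integrals_tendsto:
  assumes b: "b \<ge> 1" and a: "real (parity_shift b) < a" "a < real b + 1"
  shows "(\<lambda>N. Gamma a * integral {0..real N * pi} (\<lambda>x. sin x ^ b / x powr a)) \<longlonglongrightarrow>
    (LINT t:{0<..}|lborel. t powr (a - real (parity_shift b) - 1) * partial_sum b t)"
proof -
  let ?\<beta> = "a - real (parity_shift b)"
  define w where "w t = 2 * \<bar>indicator {0<..} t *\<^sub>R (t powr (?\<beta> - 1) * partial_sum b t)\<bar>" for t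
  define h where "h N t = indicator {0<..} t *\<^sub>R (t powr (?\<beta> - 1) * partial_sum b t *
     (1 - (-1) ^ (b * N) * exp (- (real N * pi * t))))" for N t
  have a0: "a > 0" using a by simp
  have int: "set_integrable lborel {0<..} (\<lambda>t. t powr (?\<beta> - 1) * partial_sum b t)"
    using a b by (intro partial_sum_Mellin_continuous) (auto simp: parity_shift_def)
  have eq: "Gamma a * integral {0..real N * pi} (\<lambda>x. sin x ^ b / x powr a) = integral\<^sup>L lborel (h N)" for N
  proof -
    have "Gamma a * integral {0..real N * pi} (\<lambda>x. sin x ^ b / x powr a) =
       Gamma a * (LINT x:{0..real N * pi}|lborel. sin x ^ b / x powr a)"
      by (subst set_borel_integral_eq_integral(2)[OF sin_power_over_powr_integrable]) (use a b in auto)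
    also have "\<dots> = (LINT t:{0<..}|lborel. t powr (a - 1) * (LINT x:{0..real N * pi}|lborel. sin x ^ b * exp (- (x * t))))"
      by (rule sin_power_Fubini) (use a a0 b in auto)
    also have "\<dots> = integral\<^sup>L lborel (h N)"
      unfolding set_lebesgue_integral_def[of _ "{0<..}"]
    proof (rule Bochner_Integration.integral_cong[OF refl])
      fix t :: real
      show "indicat_real {0<..} t *\<^sub>R (t powr (a - 1) * (LINT x:{0..real N * pi}|lborel. sin x ^ b * exp (- (x * t)))) = h N t"
      proof (cases "t > 0")
        case True
        have "set_integrable lborel {0..real N * pi} (\<lambda>x. sin x ^ b * exp (- (x * t)))"
          by (intro borel_integrable_atLeastAtMost' continuous_intros)
        from set_borel_integral_eq_integral(2)[OF this]
        have "(LINT x:{0..real N * pi}|lborel. sin x ^ b * exp (- (x * t))) =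
          partial_sum b t / (if even b then t else 1) * (1 - (-1) ^ (b * N) * exp (- (real N * pi * t)))"
          using integral_unique[OF sin_power_laplace[OF b True, of N]] by simp
        moreover have "t powr (a - 1) / (if even b then t else 1) = t powr (?\<beta> - 1)"
          using True powr_diff[of t "a - 1" 1] by (simp add: parity_shift_def)
        moreover have "x * (y / d * z) = x / d * y * z" for x y z d :: real by simp
        ultimately show ?thesis
          using True by (simp only: h_def)
      qed (simp add: h_def)
    qed
    finally show ?thesis .
  qed
  have M[measurable]: "partial_sum b \<in> borel_measurable borel"
    unfolding partial_sum_def[abs_def] by measurable
  have "(\<lambda>N. integral\<^sup>L lborel (h N)) \<longlonglongrightarrow> (LINT t|lborel. indicator {0<..} t *\<^sub>R (t powr (?\<beta> - 1) * partial_sum b t))"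
  proof (rule integral_dominated_convergence[where w = w])
    show "integrable lborel w"
      unfolding w_def using int unfolding set_integrable_def by (intro integrable_mult_right integrable_abs)
    show "(\<lambda>t. indicator {0<..} t *\<^sub>R (t powr (?\<beta> - 1) * partial_sum b t)) \<in> borel_measurable lborel"
      by measurable
    show "h N \<in> borel_measurable lborel" for N
      unfolding h_def by measurable
    show "AE t in lborel. norm (h N t) \<le> w t" for N
    proof (intro AE_I2)
      fix t :: real
      show "norm (h N t) \<le> w t"
      proof (cases "t > 0")
        case True
        then have "\<bar>1 - (-1) ^ (b * N) * exp (- (real N * pi * t))\<bar> \<le> 2"
          by (cases "even (b * N)") (auto simp: minus_one_power_iff abs_le_iff intro: order_trans[of _ 0])
        then have "\<bar>t powr (?\<beta> - 1) * partial_sum b t\<bar> * \<bar>1 - (-1) ^ (b * N) * exp (- (real N * pi * t))\<bar> \<le>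
          \<bar>t powr (?\<beta> - 1) * partial_sum b t\<bar> * 2"
          by (intro mult_left_mono) auto
        with True show ?thesis
          by (simp add: h_def w_def abs_mult)
      qed (simp add: h_def w_def)
    qed
    show "AE t in lborel. (\<lambda>N. h N t) \<longlonglongrightarrow> indicator {0<..} t *\<^sub>R (t powr (?\<beta> - 1) * partial_sum b t)"
    proof (intro AE_I2)
      fix t :: real
      show "(\<lambda>N. h N t) \<longlonglongrightarrow> indicator {0<..} t *\<^sub>R (t powr (?\<beta> - 1) * partial_sum b t)"
      proof (cases "t > 0")
        case True
        have "(\<lambda>N. exp (- (pi * t)) ^ N) \<longlonglongrightarrow> 0"
          using True by (intro LIMSEQ_realpow_zero) auto
        then have e: "(\<lambda>N. exp (- (real N * pi * t))) \<longlonglongrightarrow> 0"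
          by (simp add: exp_of_nat_mult[symmetric] mult.assoc)
        have "(\<lambda>N. (-1) ^ (b * N) * exp (- (real N * pi * t))) \<longlonglongrightarrow> 0"
          by (rule tendsto_rabs_zero_cancel) (use e in \<open>simp add: abs_mult power_abs\<close>)
        then have "(\<lambda>N. h N t) \<longlonglongrightarrow> indicator {0<..} t *\<^sub>R (t powr (?\<beta> - 1) * partial_sum b t * (1 - 0))"
          unfolding h_def by (intro tendsto_intros)
        then show ?thesis by simp
      qed (simp add: h_def)
    qed
  qed
  then show ?thesis
    unfolding eq set_lebesgue_integral_def .
qed

section \<open>Evaluation\<close>

text \<open>On each half-wave sin^b has the same integral \<open>S\<close> > 0, while x^a \<le> x
  for x \<ge> 1. The half-waves therefore contribute at least the terms of a multiple of the
  harmonic series.\<close>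

lemma even_sin_power_over_powr_diverges:
  fixes a :: real
  assumes b: "b \<ge> 1" "even b" and a: "0 < a" "a \<le> 1"
  shows "\<not> ((\<lambda>R. integral {1..R} (\<lambda>x. sin x ^ b / x powr a)) \<longlongrightarrow> I) at_top"
proof
  let ?g = "\<lambda>x::real. sin x ^ b / x powr a"
  assume lim: "((\<lambda>R. integral {1..R} ?g) \<longlongrightarrow> I) at_top"
  define S where "S = integral {0..pi} (\<lambda>x. sin x ^ b)"
  \<comment> \<open>With \<open>Suc n\<close> the upper endpoint is at least pi, hence beyond the
    lower endpoint 1 even for n = 0.\<close>
  define J where "J n = integral {1..real (Suc n) * pi} ?g" for n
  have S: "S > 0"
  proof -
    have c: "continuous_on {0..pi} (\<lambda>x. sin x ^ b)" by (intro continuous_intros)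
    have "S \<noteq> 0"
    proof
      assume "S = 0"
      then have "\<forall>x\<in>{0..pi}. sin x ^ b = 0"
        unfolding S_def by (subst (asm) integral_eq_0_iff[OF c pi_gt_zero]) (use b in auto)
      then have "sin (pi / 2) ^ b = 0" by (rule bspec) simp
      then show False by simp
    qed
    moreover have "S \<ge> 0"
      unfolding S_def using b c by (intro integral_nonneg integrable_continuous_real) auto
    ultimately show ?thesis by simp
  qed
  have gi: "?g integrable_on {c..d}" if "c > 0" for c d
    using that by (intro integrable_continuous_real continuous_intros) auto
  have step: "S / pi * inverse (real (n + 2)) \<le> J (Suc n) - J n" for n
  proof -
    let ?u = "real (Suc n) * pi" and ?v = "real (Suc (Suc n)) * pi"
    have u: "1 \<le> ?u" using mult_mono[of 1 "real (Suc n)" 1 pi] pi_ge_two by simp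
    have uv: "?u \<le> ?v" by simp
    have "integral {1..?u} ?g + integral {?u..?v} ?g = integral {1..?v} ?g"
      by (rule Henstock_Kurzweil_Integration.integral_combine[OF u uv gi]) simp
    then have J: "J (Suc n) - J n = integral {?u..?v} ?g" by (simp add: J_def)
    have "((\<lambda>x. sin x ^ b) \<circ> (+) ?u has_integral S) {0..pi}"
    proof -
      \<comment> \<open>The shift changes the sine at most by a sign, which the even power
        removes.\<close>
      have "sin (?u + x) ^ b = sin x ^ b" for x
        using b(2) by (simp only: sin_add sin_npi cos_npi power_mult_distrib) (simp add: power_mult_distrib flip: power_mult)
      then have "(\<lambda>x. sin x ^ b) \<circ> (+) ?u = (\<lambda>x. sin x ^ b)" by (simp add: fun_eq_iff)
      moreover have "((\<lambda>x. sin x ^ b) has_integral S) {0..pi}"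
        unfolding S_def by (intro integrable_integral integrable_continuous_real continuous_intros)
      ultimately show ?thesis by simp
    qed
    then have "((\<lambda>x. sin x ^ b) has_integral S) {0 + ?u..pi + ?u}"
      unfolding has_integral_shift_Icc_real .
    moreover have "pi + ?u = ?v" by (simp add: algebra_simps)
    ultimately have "((\<lambda>x. sin x ^ b) has_integral S) {?u..?v}" by simp
    then have "((\<lambda>x. sin x ^ b / ?v) has_integral S / ?v) {?u..?v}"
      by (rule has_integral_divide)
    moreover have "(?g has_integral integral {?u..?v} ?g) {?u..?v}"
      using u by (intro integrable_integral gi) simp
    ultimately have "S / ?v \<le> integral {?u..?v} ?g"
    proof (rule has_integral_le)
      fix x assume x: "x \<in> {?u..?v}"
      then have "x \<ge> 1" using u by auto
      then have "x powr a \<le> x powr 1" using a by (intro powr_mono) auto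
      then have "x powr a \<le> ?v" using x \<open>x \<ge> 1\<close> by simp
      then show "sin x ^ b / ?v \<le> ?g x"
        using b \<open>x \<ge> 1\<close> by (intro divide_left_mono zero_le_even_power mult_pos_pos) auto
    qed
    then show ?thesis unfolding J by (simp add: field_simps)
  qed
  have "filterlim (\<lambda>n. pi * real (Suc n)) at_top sequentially"
    by (intro filterlim_tendsto_pos_mult_at_top[OF tendsto_const] filterlim_compose[OF filterlim_real_sequentially filterlim_Suc]) auto
  then have "J \<longlonglongrightarrow> I"
    unfolding J_def by (intro filterlim_compose[OF lim]) (simp add: mult.commute)
  then have "summable (\<lambda>n. J (Suc n) - J n)" by (rule telescope_summable)
  then have "summable (\<lambda>n. S / pi * inverse (real (n + 2)))"
  proof (rule summable_comparison_test'[where N = 0])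
    show "norm (S / pi * inverse (real (n + 2))) \<le> J (Suc n) - J n" for n
      using step[of n] S by (simp add: abs_mult)
  qed
  then have "summable (\<lambda>n. inverse (real (n + 2)))"
    using S by (subst (asm) summable_cmult_iff) auto
  then have "summable (\<lambda>n. inverse (of_nat n :: real))"
    by (subst (asm) summable_iff_shift)
  with not_summable_harmonic show False by blast
qed

section \<open>Comparison of the Mellin formula with the sum in the theorem\<close>

lemma abs_sin_shift: "\<bar>sin (x + real m * pi)\<bar> = \<bar>sin x\<bar>"
  by (simp add: sin_add abs_mult)

text \<open>In sin(\<alpha> pi) = 2 sin(\<alpha> pi/2) cos(\<alpha> pi/2), one factor cancels the
  numerator up to sign. The other is, up to sign, the sine in the denominator of the Mellin
  formula.\<close>

lemma abs_sin_quotient: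
  assumes "sin (\<alpha> * pi) \<noteq> 0"
  shows "\<bar>sin ((\<alpha> + real b) * pi / 2) / sin (\<alpha> * pi)\<bar> =
    1 / (2 * \<bar>sin (pi * (\<alpha> - real (parity_shift b)) / 2)\<bar>)"
proof -
  let ?x = "\<alpha> * pi / 2"
  have d: "sin (\<alpha> * pi) = 2 * sin ?x * cos ?x"
    using sin_double[of ?x] by simp
  with assms have nz: "sin ?x \<noteq> 0" "cos ?x \<noteq> 0" by auto
  show ?thesis
  proof (cases "even b")
    case True
    then obtain m where "b = 2 * m" by (elim evenE)
    then have "(\<alpha> + real b) * pi / 2 = ?x + real m * pi" by (simp add: algebra_simps add_divide_distrib)
    then have n: "\<bar>sin ((\<alpha> + real b) * pi / 2)\<bar> = \<bar>sin ?x\<bar>" by (simp only: abs_sin_shift)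
    have "pi * (\<alpha> - real (parity_shift b)) / 2 = ?x - pi / 2"
      using True by (simp add: parity_shift_def algebra_simps diff_divide_distrib)
    then have "\<bar>sin (pi * (\<alpha> - real (parity_shift b)) / 2)\<bar> = \<bar>cos ?x\<bar>" by (simp only: sin_diff) simp
    then show ?thesis unfolding abs_divide n d using nz by (simp add: abs_mult)
  next
    case False
    then obtain m where "b = 2 * m + 1" by (elim oddE)
    then have "(\<alpha> + real b) * pi / 2 = (?x + pi / 2) + real m * pi" by (simp add: algebra_simps add_divide_distrib)
    then have "\<bar>sin ((\<alpha> + real b) * pi / 2)\<bar> = \<bar>sin (?x + pi / 2)\<bar>" by (simp only: abs_sin_shift)
    then have n: "\<bar>sin ((\<alpha> + real b) * pi / 2)\<bar> = \<bar>cos ?x\<bar>" by (simp add: sin_add)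
    have "pi * (\<alpha> - real (parity_shift b)) / 2 = ?x"
      using False by (simp add: parity_shift_def mult.commute)
    then have "\<bar>sin (pi * (\<alpha> - real (parity_shift b)) / 2)\<bar> = \<bar>sin ?x\<bar>" by (simp only:)
    then show ?thesis unfolding abs_divide n d using nz by (simp add: abs_mult)
  qed
qed

lemma abs_sum_eq_Mellin_integral:
  assumes b: "b \<ge> 1" and \<alpha>: "real (parity_shift b) < \<alpha>" "\<alpha> < real b + 1" "\<alpha> \<notin> \<int>"
  shows "\<bar>\<Sum>k=1..b. real k powr (\<alpha> - 1) * t_coeff b k * real (b choose ((b - k) div 2)) *
      (sin ((\<alpha> + real b) * pi / 2) / sin (\<alpha> * pi))\<bar> =
    2 ^ (b - 1) / pi * (LINT t:{0<..}|lborel. t powr (\<alpha> - real (parity_shift b) - 1) * partial_sum b t)"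
proof -
  let ?\<beta> = "\<alpha> - real (parity_shift b)"
  let ?G = "LINT t:{0<..}|lborel. t powr (?\<beta> - 1) * partial_sum b t"
  define S where "S = (\<Sum>k=1..b. sin_power_coeff b k * real k powr (\<alpha> - 1))"
  have "?\<beta> \<notin> \<int>" using \<alpha>(3) Ints_add[of ?\<beta> "real (parity_shift b)"] by auto
  then have nz: "sin (pi * ?\<beta> / 2) \<noteq> 0" by (rule sin_half_pi_nonzero)
  have nz': "sin (\<alpha> * pi) \<noteq> 0"
    using \<alpha>(3) by (auto simp: sin_zero_iff_int2)
  \<comment> \<open>The factor k or k^2 in \<open>partial_coeff\<close> restores the exponent
    \<alpha> - 1; for even b only a global sign remains.\<close>
  have "partial_coeff b k * real k powr (?\<beta> - 2) =
      (if even b then -1 else 1) * (sin_power_coeff b k * real k powr (\<alpha> - 1))" if "k \<ge> 1" for k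
  proof (cases "even b")
    case True
    have "real k powr (\<alpha> - 1) = real k powr (?\<beta> - 2) * real k ^ 2"
      using that True powr_add[of "real k" "?\<beta> - 2" 2] by (simp add: parity_shift_def)
    with True show ?thesis by (simp add: partial_coeff_def)
  next
    case False
    have "real k powr (\<alpha> - 1) = real k powr (?\<beta> - 2) * real k"
      using that False powr_add[of "real k" "?\<beta> - 2" 1] by (simp add: parity_shift_def)
    with False show ?thesis by (simp add: partial_coeff_def)
  qed
  then have "(\<Sum>k=1..b. partial_coeff b k * real k powr (?\<beta> - 2)) = (if even b then -1 else 1) * S"
    unfolding S_def sum_distrib_left by (intro sum.cong) auto
  moreover have "?G = (\<Sum>k=1..b. partial_coeff b k * real k powr (?\<beta> - 2)) * (pi / (2 * sin (pi * ?\<beta> / 2)))"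
    using b \<alpha> nz by (intro Mellin_partial_sum(2)) (auto simp: parity_shift_def)
  ultimately have "\<bar>?G\<bar> = \<bar>S\<bar> * (pi / (2 * \<bar>sin (pi * ?\<beta> / 2)\<bar>))"
    by (simp add: abs_mult)
  \<comment> \<open>Positivity is what allows the absolute value of the sum to recover the integral
    itself.\<close>
  moreover have "?G \<ge> 0"
    unfolding set_lebesgue_integral_def
    by (intro Bochner_Integration.integral_nonneg) (auto simp: indicator_def partial_sum_nonneg[OF b])
  ultimately have G: "?G = \<bar>S\<bar> * (pi / (2 * \<bar>sin (pi * ?\<beta> / 2)\<bar>))" by simp
  have "(\<Sum>k=1..b. real k powr (\<alpha> - 1) * t_coeff b k * real (b choose ((b - k) div 2)) *
      (sin ((\<alpha> + real b) * pi / 2) / sin (\<alpha> * pi))) =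
      2 ^ (b - 1) * S * (sin ((\<alpha> + real b) * pi / 2) / sin (\<alpha> * pi))"
    unfolding S_def sin_power_coeff_def sum_distrib_left sum_distrib_right by (intro sum.cong refl) simp
  then have "\<bar>\<Sum>k=1..b. real k powr (\<alpha> - 1) * t_coeff b k * real (b choose ((b - k) div 2)) *
      (sin ((\<alpha> + real b) * pi / 2) / sin (\<alpha> * pi))\<bar> =
      2 ^ (b - 1) * \<bar>S\<bar> * (1 / (2 * \<bar>sin (pi * ?\<beta> / 2)\<bar>))"
    by (simp only: abs_mult abs_sin_quotient[OF nz']) simp
  then show ?thesis unfolding G by simp
qed

theorem mainTheorem4:
  fixes a :: real and b :: nat
  assumes "b \<ge> 1" and "0 < a" and "a < real b + 1"
    and "improper_integral_converges (\<lambda>x. sin x ^ b / x powr a)"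
  shows "\<exists>L. ((\<lambda>\<alpha>. \<bar>\<Sum>k=1..b. real k powr (\<alpha> - 1) * t_coeff b k * real (b choose ((b - k) div 2)) *
                      (sin ((\<alpha> + real b) * pi / 2) / sin (\<alpha> * pi))\<bar>) \<longlongrightarrow> L) (at a) \<and>
             improper_integral (\<lambda>x. sin x ^ b / x powr a) = pi / (2 ^ (b - 1) * Gamma a) * L"
proof -
  let ?g = "\<lambda>x::real. sin x ^ b / x powr a"
  let ?e = "real (parity_shift b)"
  define G where "G s = (LINT t:{0<..}|lborel. t powr (s - 1) * partial_sum b t)" for s
  obtain I where I: "has_improper_integral ?g I"
    using assms(4) unfolding improper_integral_converges_def by blast
  then obtain I0 I1 where I0: "((\<lambda>\<epsilon>. integral {\<epsilon>..1} ?g) \<longlongrightarrow> I0) (at_right 0)"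
    and I1: "((\<lambda>R. integral {1..R} ?g) \<longlongrightarrow> I1) at_top" and I01: "I = I0 + I1"
    unfolding has_improper_integral_def by blast
  \<comment> \<open>Convergence at infinity forces a > 1 for even b, so the Mellin exponent is
    positive.\<close>
  have ea: "?e < a"
  proof (cases "even b")
    case True
    then show ?thesis
      using even_sin_power_over_powr_diverges[OF assms(1) True assms(2)] I1
      by (auto simp: parity_shift_def not_le[symmetric])
  qed (use assms(2) in \<open>simp add: parity_shift_def\<close>)
  have gi: "?g integrable_on {0..c}" if "c \<ge> 0" for c
    using set_borel_integral_eq_integral(1)[OF sin_power_over_powr_integrable[OF assms(1,3) that]] .
  \<comment> \<open>Near 0 the integrand is integrable, so the improper limit is an ordinary
    integral.\<close>
  have "((\<lambda>\<epsilon>. integral {\<epsilon>..1} ?g) \<longlongrightarrow> integral {0..1} ?g) (at 0 within {0..1})"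
    using indefinite_integral_continuous_1'[OF gi[of 1]] by (simp add: continuous_on)
  then have I0': "I0 = integral {0..1} ?g"
    using tendsto_unique[OF _ I0] by (simp add: at_within_Icc_at_right)
  \<comment> \<open>Since the limit over all R exists, it can be computed along R = N pi.\<close>
  have "filterlim (\<lambda>N. pi * real N) at_top sequentially"
    by (intro filterlim_tendsto_pos_mult_at_top[OF tendsto_const] filterlim_real_sequentially) auto
  then have "(\<lambda>N. integral {1..real N * pi} ?g) \<longlonglongrightarrow> I1"
    by (intro filterlim_compose[OF I1]) (simp add: mult.commute)
  then have "(\<lambda>N. Gamma a * (I0 + integral {1..real N * pi} ?g)) \<longlonglongrightarrow> Gamma a * I"
    unfolding I01 by (intro tendsto_intros)
  moreover have "\<forall>\<^sub>F N in sequentially. Gamma a * (I0 + integral {1..real N * pi} ?g) =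
      Gamma a * integral {0..real N * pi} ?g"
    using eventually_ge_at_top[of 1]
  proof eventually_elim
    case (elim N)
    then have N: "1 \<le> real N * pi" using mult_mono[of 1 "real N" 1 pi] pi_ge_two by simp
    then show ?case
      unfolding I0' using Henstock_Kurzweil_Integration.integral_combine[OF _ N gi[of "real N * pi"]] by simp
  qed
  ultimately have "(\<lambda>N. Gamma a * integral {0..real N * pi} ?g) \<longlonglongrightarrow> Gamma a * I"
    by (rule Lim_transform_eventually)
  then have GI: "Gamma a * I = G (a - ?e)"
    unfolding G_def by (rule LIMSEQ_unique[OF _ sin_power_truncated_integrals_tendsto[OF assms(1) ea assms(3)]])
  \<comment> \<open>The explicit sum equals the Mellin integral only at non-integral \<alpha>.
    Continuity of the latter gives the limit at a, integral or not.\<close>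
  have "(G \<longlongrightarrow> G (a - ?e)) (at (a - ?e))"
    unfolding G_def using ea assms
    by (intro partial_sum_Mellin_continuous) (auto simp: parity_shift_def)
  moreover have "filterlim (\<lambda>\<alpha>. \<alpha> - ?e) (at (a - ?e)) (at a)"
    by (intro filterlim_atI tendsto_intros) (auto simp: eventually_at_filter)
  ultimately have "((\<lambda>\<alpha>. G (\<alpha> - ?e)) \<longlongrightarrow> G (a - ?e)) (at a)"
    by (rule filterlim_compose)
  then have "((\<lambda>\<alpha>. 2 ^ (b - 1) / pi * G (\<alpha> - ?e)) \<longlongrightarrow> 2 ^ (b - 1) / pi * G (a - ?e)) (at a)"
    by (rule tendsto_mult_left)
  moreover have "\<forall>\<^sub>F \<alpha> in at a. 2 ^ (b - 1) / pi * G (\<alpha> - ?e) =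
      \<bar>\<Sum>k=1..b. real k powr (\<alpha> - 1) * t_coeff b k * real (b choose ((b - k) div 2)) *
                      (sin ((\<alpha> + real b) * pi / 2) / sin (\<alpha> * pi))\<bar>"
  proof -
    have "\<forall>\<^sub>F \<alpha> in at a. ?e < \<alpha> \<and> \<alpha> < real b + 1 \<and> \<alpha> \<notin> \<int>"
      using ea assms(3)
      by (intro eventually_conj order_tendstoD[OF tendsto_ident_at] eventually_not_Ints_at)
    then show ?thesis
    proof eventually_elim
      case (elim \<alpha>)
      then show ?case
        unfolding G_def using assms(1) by (intro abs_sum_eq_Mellin_integral[symmetric]) auto
    qed
  qed
  ultimately have "((\<lambda>\<alpha>. \<bar>\<Sum>k=1..b. real k powr (\<alpha> - 1) * t_coeff b k * real (b choose ((b - k) div 2)) *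
                      (sin ((\<alpha> + real b) * pi / 2) / sin (\<alpha> * pi))\<bar>) \<longlongrightarrow> 2 ^ (b - 1) / pi * G (a - ?e)) (at a)"
    by (rule Lim_transform_eventually)
  moreover have "improper_integral ?g = pi / (2 ^ (b - 1) * Gamma a) * (2 ^ (b - 1) / pi * G (a - ?e))"
    unfolding GI[symmetric] improper_integral_eqI[OF I] using Gamma_real_pos[OF assms(2)] by simp
  ultimately show ?thesis by blast
qed

end
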